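(* Let $[a,b]\subset\mathbb{R}$ be a bounded interval, let $T:\mathcal{L}^2[a,b]\to\mathcal{L}^2[a,b]$ be a bounded injective linear operator with adjoint $T^*$, let $\varphi\in\mathcal{L}^2[a,b]$ and $g=T\varphi$. For $\psi\in\mathcal{L}^2[a,b]$ put $u:=-\Delta^{-1}g$, $u_\psi:=-\Delta^{-1}(T\psi)$, and $$G_2(\psi):=\|u'-u_\psi'\|_{\mathcal{L}^2}^2 .$$ Then: 1. For every $\psi\in\mathcal{L}^2[a,b]$, $$G_2(\psi)=\int_a^b \big(u'^2-u_\psi'^2\big)-2(T\psi)(u-u_\psi)\,dx .$$ 2. For any $\psi_1,\psi_2\in\mathcal{L}^2[a,b]$, $$G_2(\psi_1)-G_2(\psi_2)=\int_a^b -2\,\big(T(\psi_1-\psi_2)\big)\Big(u-\frac{u_{\psi_1}+u_{\psi_2}}{2}\Big)\,dx .$$ 3. The first Gâteaux differential of $G_2$ at $\psi\in\mathcal{L}^2[a,b]$ is $$G_2'(\psi)[h]=\int_a^b (Th)\big(-2(u-u_\psi)\big)\,dx,\qquad h\in\mathcal{L}^2[a,b],$$ and the $\mathcal{L}^2$-gradient of $G_2$ at $\psi$ is $\nabla_{\mathcal{L}^2}^{\psi}G_2=T^*\big(-2(u-u_\psi)\big)$. 4. The second Gâteaux differential of $G_2$ at any $\psi\in\mathcal{L}^2[a,b]$ is $$G_2''(\psi)[h,k]=2\big(-\Delta^{-1}(Th),\,Tk\big)_{\mathcal{L}^2},\qquad h,k\in\mathcal{L}^2[a,b].$$ Hence for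 any $\psi\in\mathcal{L}^2[a,b]$, $G_2''(\psi)$ is a positive definite quadratic form. Thus $G_2$ is a strictly convex functional and has a unique global minimum, which is attained at $\varphi$. (If the injectivity assumption on $T$ is dropped, $G_2$ is a convex functional.)
   Context: All functions are real-valued on $[a,b]$; $(\cdot,\cdot)_{\mathcal{L}^2}$ and $\|\cdot\|_{\mathcal{L}^2}$ are the usual inner product and norm of $\mathcal{L}^2[a,b]$. For $f\in\mathcal{L}^2[a,b]$, $y=-\Delta^{-1}f$ denotes the unique solution $y\in\mathcal{H}^2_0[a,b]$ of $-y''=f$, $y(a)=0$, $y(b)=0$; here $\mathcal{H}^2_0[a,b]$ is the set of functions in the Sobolev space $\mathcal{H}^2[a,b]$ that vanish at $a$ and $b$, and $\Delta=\partial^2/\partial x^2$ on $\mathcal{H}^2_0[a,b]$. The first Gâteaux differential of a functional $G_2$ at $\psi$ in direction $h$ is $G_2'(\psi)[h]=\lim_{\epsilon\to0}\epsilon^{-1}(G_2(\psi+\epsilon h)-G_2(\psi))$, and the second is $G_2''(\psi)[h,k]=\lim_{\epsilon\to0}\epsilon^{-1}(G_2'(\psi+\epsilon h)[k]-G_2'(\psi)[k])$. The $\mathcal{L}^2$-gradient at $\psi$ is the element $\nabla_{\mathcal{L}^2}^{\psi}G_2\in\mathcal{L}^2[a,b]$ with $G_2'(\psi)[h]=(h,\nabla_{\mathcal{L}^2}^{\psi}G_2)_{\mathcal{L}^2}$ for all $h\in\mathcal{L}^2[a,b]$. *)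

theory Defs
  imports "HOL-Analysis.Analysis"
begin

text \<open>
  Elements of the real space L^2[a,b] are represented by functions \<open>real \<Rightarrow> real\<close> that are
  square integrable for Lebesgue measure on \<open>{a..b}\<close>; equality in L^2[a,b] is equality
  almost everywhere, \<open>L2_eq\<close>.
\<close>

definition L2 :: "real \<Rightarrow> real \<Rightarrow> (real \<Rightarrow> real) set" where
  "L2 a b = {f. f \<in> borel_measurable (lebesgue_on {a..b}) \<and>
                integrable (lebesgue_on {a..b}) (\<lambda>x. (f x)\<^sup>2)}"

definition L2_eq :: "real \<Rightarrow> real \<Rightarrow> (real \<Rightarrow> real) \<Rightarrow> (real \<Rightarrow> real) \<Rightarrow> bool" where
  "L2_eq a b f g \<longleftrightarrow> (AE x in lebesgue_on {a..b}. f x = g x)"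

definition L2_inner :: "real \<Rightarrow> real \<Rightarrow> (real \<Rightarrow> real) \<Rightarrow> (real \<Rightarrow> real) \<Rightarrow> real" where
  "L2_inner a b f g = (LINT x|lebesgue_on {a..b}. f x * g x)"

definition L2_norm :: "real \<Rightarrow> real \<Rightarrow> (real \<Rightarrow> real) \<Rightarrow> real" where
  "L2_norm a b f = sqrt (L2_inner a b f f)"

text \<open>
  Boundedness and linearity together imply that the operator respects \<open>L2_eq\<close>, so it
  induces an operator on equivalence classes; this need not be required separately.
\<close>

definition L2_bounded_linear :: "real \<Rightarrow> real \<Rightarrow> ((real \<Rightarrow> real) \<Rightarrow> (real \<Rightarrow> real)) \<Rightarrow> bool" where
  "L2_bounded_linear a b T \<longleftrightarrow>
     (\<forall>f\<in>L2 a b. T f \<in> L2 a b) \<and>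
     (\<forall>f\<in>L2 a b. \<forall>g\<in>L2 a b. L2_eq a b (T (\<lambda>x. f x + g x)) (\<lambda>x. T f x + T g x)) \<and>
     (\<forall>c. \<forall>f\<in>L2 a b. L2_eq a b (T (\<lambda>x. c * f x)) (\<lambda>x. c * T f x)) \<and>
     (\<exists>C. \<forall>f\<in>L2 a b. L2_norm a b (T f) \<le> C * L2_norm a b f)"

definition L2_injective :: "real \<Rightarrow> real \<Rightarrow> ((real \<Rightarrow> real) \<Rightarrow> (real \<Rightarrow> real)) \<Rightarrow> bool" where
  "L2_injective a b T \<longleftrightarrow>
     (\<forall>f\<in>L2 a b. \<forall>g\<in>L2 a b. L2_eq a b (T f) (T g) \<longrightarrow> L2_eq a b f g)"

definition L2_is_adjoint ::
  "real \<Rightarrow> real \<Rightarrow> ((real \<Rightarrow> real) \<Rightarrow> (real \<Rightarrow> real)) \<Rightarrow> ((real \<Rightarrow> real) \<Rightarrow> (real \<Rightarrow> real)) \<Rightarrow> bool" where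
  "L2_is_adjoint a b T Ts \<longleftrightarrow>
     (\<forall>g\<in>L2 a b. Ts g \<in> L2 a b) \<and>
     (\<forall>f\<in>L2 a b. \<forall>g\<in>L2 a b. L2_inner a b (T f) g = L2_inner a b f (Ts g))"

text \<open>
  The test functions are the smooth functions whose support is a compact subset of the
  open interval \<open>{a<..<b}\<close>.
\<close>

definition test_functions :: "real \<Rightarrow> real \<Rightarrow> (real \<Rightarrow> real) set" where
  "test_functions a b =
     {\<eta>. (\<forall>n x. (deriv ^^ n) \<eta> differentiable (at x)) \<and>
         (\<exists>c d. a < c \<and> d < b \<and> (\<forall>x. x \<notin> {c..d} \<longrightarrow> \<eta> x = 0))}"

definition has_weak_deriv ::
  "real \<Rightarrow> real \<Rightarrow> nat \<Rightarrow> (real \<Rightarrow> real) \<Rightarrow> (real \<Rightarrow> real) \<Rightarrow> bool" where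
  "has_weak_deriv a b n f v \<longleftrightarrow>
     v \<in> L2 a b \<and>
     (\<forall>\<eta>\<in>test_functions a b.
        (LINT x|lebesgue_on {a..b}. f x * (deriv ^^ n) \<eta> x)
          = (-1) ^ n * (LINT x|lebesgue_on {a..b}. v x * \<eta> x))"

text \<open>The weak derivative is determined only almost everywhere; a representative is chosen.\<close>

definition weak_deriv :: "real \<Rightarrow> real \<Rightarrow> nat \<Rightarrow> (real \<Rightarrow> real) \<Rightarrow> (real \<Rightarrow> real)" where
  "weak_deriv a b n f = (SOME v. has_weak_deriv a b n f v)"

definition sobolev_H :: "nat \<Rightarrow> real \<Rightarrow> real \<Rightarrow> (real \<Rightarrow> real) set" where
  "sobolev_H m a b = {f \<in> L2 a b. \<forall>n\<le>m. \<exists>v. has_weak_deriv a b n f v}"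

text \<open>
  The boundary values of an element of H^2[a,b] are those of its continuous representative,
  so the elements of \<open>H2_0\<close> are required to be that representative.
\<close>

definition H2_0 :: "real \<Rightarrow> real \<Rightarrow> (real \<Rightarrow> real) set" where
  "H2_0 a b = {y \<in> sobolev_H 2 a b. continuous_on {a..b} y \<and> y a = 0 \<and> y b = 0}"

text \<open>
  The solution is unique on \<open>{a..b}\<close>, but not as a function on all of \<open>real\<close>; hence
  \<open>SOME\<close> rather than \<open>THE\<close>.
\<close>

definition neg_inv_laplacian :: "real \<Rightarrow> real \<Rightarrow> (real \<Rightarrow> real) \<Rightarrow> (real \<Rightarrow> real)" where
  "neg_inv_laplacian a b f =
     (SOME y. y \<in> H2_0 a b \<and> L2_eq a b (\<lambda>x. - weak_deriv a b 2 y x) f)"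

definition has_gateaux_diff ::
  "((real \<Rightarrow> real) \<Rightarrow> real) \<Rightarrow> (real \<Rightarrow> real) \<Rightarrow> (real \<Rightarrow> real) \<Rightarrow> real \<Rightarrow> bool" where
  "has_gateaux_diff F \<psi> h D \<longleftrightarrow>
     ((\<lambda>\<epsilon>. (F (\<lambda>x. \<psi> x + \<epsilon> * h x) - F \<psi>) / \<epsilon>) \<longlongrightarrow> D) (at 0)"

definition gateaux_diff ::
  "((real \<Rightarrow> real) \<Rightarrow> real) \<Rightarrow> (real \<Rightarrow> real) \<Rightarrow> (real \<Rightarrow> real) \<Rightarrow> real" where
  "gateaux_diff F \<psi> h = (THE D. has_gateaux_diff F \<psi> h D)"

definition has_gateaux_diff2 ::
  "((real \<Rightarrow> real) \<Rightarrow> real) \<Rightarrow> (real \<Rightarrow> real) \<Rightarrow> (real \<Rightarrow> real) \<Rightarrow> (real \<Rightarrow> real) \<Rightarrow> real \<Rightarrow> bool" where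
  "has_gateaux_diff2 F \<psi> h k D \<longleftrightarrow> has_gateaux_diff (\<lambda>\<theta>. gateaux_diff F \<theta> k) \<psi> h D"

definition gateaux_diff2 ::
  "((real \<Rightarrow> real) \<Rightarrow> real) \<Rightarrow> (real \<Rightarrow> real) \<Rightarrow> (real \<Rightarrow> real) \<Rightarrow> (real \<Rightarrow> real) \<Rightarrow> real" where
  "gateaux_diff2 F \<psi> h k = (THE D. has_gateaux_diff2 F \<psi> h k D)"

definition is_L2_gradient ::
  "real \<Rightarrow> real \<Rightarrow> ((real \<Rightarrow> real) \<Rightarrow> real) \<Rightarrow> (real \<Rightarrow> real) \<Rightarrow> (real \<Rightarrow> real) \<Rightarrow> bool" where
  "is_L2_gradient a b F \<psi> w \<longleftrightarrow>
     w \<in> L2 a b \<and> (\<forall>h\<in>L2 a b. has_gateaux_diff F \<psi> h (L2_inner a b h w))"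

text \<open>
  The quadratic form \<open>\<lambda>h. B h h\<close> of a symmetric bilinear form \<open>B\<close> on L^2[a,b] is positive
  definite.
\<close>

definition L2_pos_def_quadratic_form ::
  "real \<Rightarrow> real \<Rightarrow> ((real \<Rightarrow> real) \<Rightarrow> (real \<Rightarrow> real) \<Rightarrow> real) \<Rightarrow> bool" where
  "L2_pos_def_quadratic_form a b B \<longleftrightarrow>
     (\<forall>h\<in>L2 a b. \<forall>k\<in>L2 a b. B h k = B k h) \<and>
     (\<forall>h1\<in>L2 a b. \<forall>h2\<in>L2 a b. \<forall>k\<in>L2 a b. B (\<lambda>x. h1 x + h2 x) k = B h1 k + B h2 k) \<and>
     (\<forall>c. \<forall>h\<in>L2 a b. \<forall>k\<in>L2 a b. B (\<lambda>x. c * h x) k = c * B h k) \<and>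
     (\<forall>h\<in>L2 a b. B h h \<ge> 0 \<and> (B h h = 0 \<longleftrightarrow> L2_eq a b h (\<lambda>x. 0)))"

definition L2_convex :: "real \<Rightarrow> real \<Rightarrow> ((real \<Rightarrow> real) \<Rightarrow> real) \<Rightarrow> bool" where
  "L2_convex a b F \<longleftrightarrow>
     (\<forall>\<psi>1\<in>L2 a b. \<forall>\<psi>2\<in>L2 a b. \<forall>t. 0 \<le> t \<and> t \<le> 1 \<longrightarrow>
        F (\<lambda>x. (1 - t) * \<psi>1 x + t * \<psi>2 x) \<le> (1 - t) * F \<psi>1 + t * F \<psi>2)"

definition L2_strictly_convex :: "real \<Rightarrow> real \<Rightarrow> ((real \<Rightarrow> real) \<Rightarrow> real) \<Rightarrow> bool" where
  "L2_strictly_convex a b F \<longleftrightarrow>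
     (\<forall>\<psi>1\<in>L2 a b. \<forall>\<psi>2\<in>L2 a b. \<forall>t. \<not> L2_eq a b \<psi>1 \<psi>2 \<and> 0 < t \<and> t < 1 \<longrightarrow>
        F (\<lambda>x. (1 - t) * \<psi>1 x + t * \<psi>2 x) < (1 - t) * F \<psi>1 + t * F \<psi>2)"

definition L2_global_min :: "real \<Rightarrow> real \<Rightarrow> ((real \<Rightarrow> real) \<Rightarrow> real) \<Rightarrow> (real \<Rightarrow> real) \<Rightarrow> bool" where
  "L2_global_min a b F \<psi> \<longleftrightarrow> \<psi> \<in> L2 a b \<and> (\<forall>\<theta>\<in>L2 a b. F \<psi> \<le> F \<theta>)"

end

theory Submission
  imports Defs "HOL-Computational_Algebra.Polynomial"
begin

text \<open>
  Everything rests on one bilinear form. Write \<open>u\<^sub>h\<close> for the solution of \<open>- y'' = T h\<close> with zero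
  boundary values and put \<open>B h k = \<integral> u\<^sub>h' u\<^sub>k'\<close>. Since solving the Dirichlet problem is linear,
  \<open>G2 \<psi> = B (\<phi> - \<psi>) (\<phi> - \<psi>)\<close>, and Green's formula (\<open>dirichlet_green\<close>) gives
  \<open>B h k = \<integral> (T h) u\<^sub>k\<close>. Every formula of the theorem is an identity for \<open>B\<close> rewritten with Green's
  formula: the two expressions for \<open>G2\<close> by expanding squares, the Gateaux differentials
  \<open>-2 B h (\<phi> - \<psi>)\<close> and \<open>2 B h k\<close> as coefficients of a polynomial in \<open>\<epsilon>\<close>, and the gradient by
  moving \<open>T\<close> to the other side of the inner product. Convexity comes from \<open>B h h \<ge> 0\<close>. If \<open>T\<close>
  is injective then \<open>B\<close> is definite (\<open>dirichlet_energy_eq_0_iff\<close>): zero energy makes the primitive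
  of \<open>T h\<close> constant, hence \<open>T h = 0\<close> and \<open>h = 0\<close>. This gives strict convexity and the uniqueness of
  the minimiser \<open>\<phi>\<close>. The purely algebraic part is carried out in the locales
  \<open>L2_quadratic_misfit\<close> and \<open>L2_definite_quadratic_misfit\<close>.

  The analytic work is to tie the solution operator and the weak derivatives, both of which are
  arbitrary choices among representatives, to concrete functions. The Dirichlet problem has the
  explicit solution obtained by integrating \<open>f\<close> twice (\<open>dirichlet_solution\<close>). That it is a weak
  solution is integration by parts for primitives of integrable functions, proved with Fubini
  (\<open>integral_by_parts_primitives\<close>). That it is the only one
  (\<open>dirichlet_solution_unique\<close>), and that weak derivatives are unique almost everywhere, follows from
  the fundamental lemma of the calculus of variations and the lemma of du Bois-Reymond. These
  need enough test functions, which are built from \<open>exp (- 1 / x)\<close>.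
\<close>

section \<open>Smooth bump functions\<close>

text \<open>
  Level 0 already stands for one derivative. The recursion, unlike an iterated derivative, lets an
  induction pass from \<open>f\<close> to \<open>deriv f\<close>, which is the form in which the sum, product and chain rules
  apply.
\<close>

primrec differentiable_upto :: "nat \<Rightarrow> (real \<Rightarrow> real) \<Rightarrow> bool" where
  "differentiable_upto 0 f \<longleftrightarrow> (\<forall>x. f differentiable (at x))"
| "differentiable_upto (Suc n) f \<longleftrightarrow>
     (\<forall>x. f differentiable (at x)) \<and> differentiable_upto n (deriv f)"

lemma differentiable_upto_iff:
  "differentiable_upto n f \<longleftrightarrow> (\<forall>k\<le>n. \<forall>x. (deriv ^^ k) f differentiable (at x))"
proof (induction n arbitrary: f)
  case (Suc n)
  have "(\<forall>k\<le>Suc n. \<forall>x. (deriv ^^ k) f differentiable (at x)) \<longleftrightarrow>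
        (\<forall>x. f differentiable (at x)) \<and> (\<forall>k\<le>n. \<forall>x. (deriv ^^ Suc k) f differentiable (at x))"
    by (metis (no_types, lifting) Suc_le_mono funpow_0 le0 not0_implies_Suc)
  then show ?case
    by (simp only: Suc.IH funpow_Suc_right o_def differentiable_upto.simps)
qed simp

lemma all_derivs_differentiable_iff:
  "(\<forall>n x. (deriv ^^ n) f differentiable (at x)) \<longleftrightarrow> (\<forall>n. differentiable_upto n f)"
  by (auto simp: differentiable_upto_iff)

lemma differentiable_upto_imp_differentiable: "differentiable_upto n f \<Longrightarrow> f differentiable (at x)"
  by (cases n) auto

lemma differentiable_upto_Suc_D: "differentiable_upto (Suc n) f \<Longrightarrow> differentiable_upto n f"
  by (simp add: differentiable_upto_iff)

lemma differentiable_imp_has_deriv: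
  fixes f :: "real \<Rightarrow> real"
  shows "f differentiable (at x) \<Longrightarrow> (f has_real_derivative deriv f x) (at x)"
  by (simp add: DERIV_deriv_iff_real_differentiable)

lemma differentiable_upto_const: "differentiable_upto n (\<lambda>x. c)"
proof (induction n arbitrary: c)
  case (Suc n)
  have "deriv (\<lambda>x::real. c) = (\<lambda>x. 0)" by (auto simp: fun_eq_iff)
  then show ?case using Suc[of 0] by simp
qed simp

lemma differentiable_upto_add:
  "differentiable_upto n f \<Longrightarrow> differentiable_upto n g \<Longrightarrow> differentiable_upto n (\<lambda>x. f x + g x)"
proof (induction n arbitrary: f g)
  case (Suc n)
  then have "\<And>x. ((\<lambda>x. f x + g x) has_real_derivative deriv f x + deriv g x) (at x)"
    by (auto intro!: derivative_intros differentiable_imp_has_deriv)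
  then have "deriv (\<lambda>x. f x + g x) = (\<lambda>x. deriv f x + deriv g x)"
    by (auto intro!: DERIV_imp_deriv)
  with Suc show ?case by auto
qed auto

text \<open>
  The Leibniz rule for \<open>(f g)'\<close> produces products of functions that are still
  \<open>n\<close> levels smooth, which is why the induction runs over both factors at once.
\<close>

lemma differentiable_upto_mult:
  "differentiable_upto n f \<Longrightarrow> differentiable_upto n g \<Longrightarrow> differentiable_upto n (\<lambda>x. f x * g x)"
proof (induction n arbitrary: f g)
  case (Suc n)
  then have "\<And>x. ((\<lambda>x. f x * g x) has_real_derivative deriv f x * g x + f x * deriv g x) (at x)"
    by (auto intro!: derivative_eq_intros differentiable_imp_has_deriv)
  then have "deriv (\<lambda>x. f x * g x) = (\<lambda>x. deriv f x * g x + f x * deriv g x)"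
    by (auto intro!: DERIV_imp_deriv)
  moreover have "differentiable_upto n (\<lambda>x. deriv f x * g x + f x * deriv g x)"
    using Suc.prems by (auto intro!: differentiable_upto_add Suc.IH intro: differentiable_upto_Suc_D
        simp del: differentiable_upto.simps(2) dest: differentiable_upto.simps(2)[THEN iffD1])
  ultimately show ?case using Suc.prems by auto
qed auto

lemma differentiable_upto_affine:
  "differentiable_upto n f \<Longrightarrow> differentiable_upto n (\<lambda>x. f (r * x + s))"
proof (induction n arbitrary: f)
  case 0
  have "((\<lambda>x. f (r * x + s)) has_real_derivative deriv f (r * x + s) * r) (at x)" for x
    by (rule DERIV_chain2[where g = "\<lambda>x. r * x + s"])
       (use 0 in \<open>auto intro!: differentiable_imp_has_deriv derivative_eq_intros\<close>)
  then show ?case by (auto simp: real_differentiable_def)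
next
  case (Suc n)
  have d: "((\<lambda>x. f (r * x + s)) has_real_derivative deriv f (r * x + s) * r) (at x)" for x
    by (rule DERIV_chain2[where g = "\<lambda>x. r * x + s"])
       (use Suc.prems in \<open>auto intro!: differentiable_imp_has_deriv derivative_eq_intros\<close>)
  then have "deriv (\<lambda>x. f (r * x + s)) = (\<lambda>x. deriv f (r * x + s) * r)"
    by (auto intro!: DERIV_imp_deriv)
  moreover have "differentiable_upto n (\<lambda>x. deriv f (r * x + s) * r)"
    using Suc by (intro differentiable_upto_mult differentiable_upto_const Suc.IH) auto
  ultimately show ?case using d by (auto simp: real_differentiable_def)
qed

text \<open>
  The family is indexed by polynomials because it is then closed under differentiation:
  differentiating \<open>p(1/x) exp(-1/x)\<close> gives \<open>(p - p')(1/x) exp(-1/x) / x\<^sup>2\<close>.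
  Smoothness of the classical flat function \<open>flat_exp 1\<close> follows from this by one induction.
\<close>

definition flat_exp :: "real poly \<Rightarrow> real \<Rightarrow> real" where
  "flat_exp p x = (if x > 0 then poly p (1 / x) * exp (- (1 / x)) else 0)"

lemma poly_times_exp_minus_tendsto_0:
  "((\<lambda>t::real. poly p t * exp (- t)) \<longlongrightarrow> 0) at_top"
proof -
  have "((\<lambda>t::real. \<Sum>i\<le>degree p. coeff p i * (t ^ i / exp t)) \<longlongrightarrow> (\<Sum>i\<le>degree p. coeff p i * 0)) at_top"
    by (intro tendsto_intros tendsto_power_div_exp_0)
  then show ?thesis
    by (simp add: poly_altdef exp_minus sum_distrib_right divide_inverse mult.assoc)
qed

text \<open>
  Away from 0 this is calculus. At 0 the difference quotient from the right is, in terms of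
  \<open>t = 1/h\<close>, a polynomial in \<open>t\<close> times \<open>exp (-t)\<close>, and the exponential wins.
\<close>

lemma flat_exp_has_derivative:
  "(flat_exp p has_real_derivative flat_exp ([:0, 0, 1:] * (p - pderiv p)) x) (at x)"
proof -
  consider "x > 0" | "x < 0" | "x = 0" by linarith
  then show ?thesis
  proof cases
    case 1
    have "((\<lambda>x. poly p (1 / x) * exp (- (1 / x))) has_real_derivative
            flat_exp ([:0, 0, 1:] * (p - pderiv p)) x) (at x)"
      using 1 by (auto intro!: derivative_eq_intros DERIV_chain2[OF poly_DERIV]
          simp: flat_exp_def field_simps power2_eq_square)
    then show ?thesis
      by (rule has_field_derivative_transform_within_open[where S = "{0<..}"])
         (use 1 in \<open>auto simp: flat_exp_def\<close>)
  next
    case 2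
    have "((\<lambda>x. 0) has_real_derivative flat_exp ([:0, 0, 1:] * (p - pderiv p)) x) (at x)"
      using 2 by (auto simp: flat_exp_def)
    then show ?thesis
      by (rule has_field_derivative_transform_within_open[where S = "{..<0}"])
         (use 2 in \<open>auto simp: flat_exp_def\<close>)
  next
    case 3
    have r: "((\<lambda>h. flat_exp p h / h) \<longlongrightarrow> 0) (at_right 0)"
    proof -
      have "((\<lambda>h. poly ([:0, 1:] * p) (inverse h) * exp (- (inverse h))) \<longlongrightarrow> 0) (at_right (0::real))"
        by (rule filterlim_compose[OF poly_times_exp_minus_tendsto_0 filterlim_inverse_at_top_right])
      moreover have "\<forall>\<^sub>F h in at_right (0::real). poly ([:0, 1:] * p) (inverse h) * exp (- (inverse h)) = flat_exp p h / h"
        by (rule eventually_at_rightI[of 0 1]) (auto simp: flat_exp_def divide_inverse)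
      ultimately show ?thesis by (rule Lim_transform_eventually)
    qed
    have l: "((\<lambda>h. flat_exp p h / h) \<longlongrightarrow> 0) (at_left 0)"
      by (rule tendsto_eventually, rule eventually_at_leftI[of "-1"]) (auto simp: flat_exp_def)
    from l r have "((\<lambda>h. flat_exp p h / h) \<longlongrightarrow> 0) (at 0)"
      by (simp add: filterlim_split_at)
    moreover have "flat_exp q 0 = 0" for q by (simp add: flat_exp_def)
    ultimately show ?thesis unfolding 3 DERIV_def by simp
  qed
qed

lemma differentiable_upto_flat_exp: "differentiable_upto n (flat_exp p)"
proof (induction n arbitrary: p)
  case 0
  show ?case using flat_exp_has_derivative by (auto simp: real_differentiable_def)
next
  case (Suc n)
  have "deriv (flat_exp p) = flat_exp ([:0, 0, 1:] * (p - pderiv p))"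
    by (rule ext, rule DERIV_imp_deriv, rule flat_exp_has_derivative)
  then show ?case using flat_exp_has_derivative Suc by (auto simp: real_differentiable_def)
qed

text \<open>
  Dilating the flat function by \<open>n + 1\<close> replaces its values on the positive half line by their
  \<open>(n + 1)\<close>-st roots. Hence the bumps stay smooth with support in \<open>{c..d}\<close> but increase to the
  indicator of the open interval.
\<close>

definition bump :: "nat \<Rightarrow> real \<Rightarrow> real \<Rightarrow> real \<Rightarrow> real" where
  "bump n c d x = flat_exp 1 (real (Suc n) * (x - c)) * flat_exp 1 (real (Suc n) * (d - x))"

lemma bump_test_function:
  assumes "a < c" "d < b"
  shows "bump n c d \<in> test_functions a b"
proof -
  have "differentiable_upto m (bump n c d)" for m
  proof -
    have "differentiable_upto m (\<lambda>x. flat_exp 1 (real (Suc n) * x + - real (Suc n) * c) *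
                                     flat_exp 1 (- real (Suc n) * x + real (Suc n) * d))"
      by (intro differentiable_upto_mult differentiable_upto_affine differentiable_upto_flat_exp)
    then show ?thesis by (simp add: bump_def[abs_def] algebra_simps)
  qed
  moreover have "bump n c d x = 0" if "x \<notin> {c..d}" for x
    using that by (auto simp: bump_def flat_exp_def zero_less_mult_iff)
  ultimately show ?thesis
    using assms unfolding test_functions_def by (auto simp: all_derivs_differentiable_iff)
qed

lemma bump_bounds: "0 \<le> bump n c d x" "bump n c d x \<le> 1"
  by (auto simp: bump_def flat_exp_def intro!: mult_le_one)

lemma flat_exp_1_tendsto:
  "(\<lambda>n. flat_exp 1 (real (Suc n) * y)) \<longlonglongrightarrow> (if y > 0 then 1 else 0)"
proof (cases "y > 0")
  case True
  have "(\<lambda>n. exp (- (inverse (real (Suc n)) * (1 / y)))) \<longlonglongrightarrow> exp (- (0 * (1 / y)))"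
    by (intro tendsto_intros LIMSEQ_inverse_real_of_nat)
  then show ?thesis using True by (simp add: flat_exp_def divide_inverse zero_less_mult_iff mult.commute)
qed (auto simp: flat_exp_def zero_less_mult_iff)

lemma bump_tendsto_indicator: "(\<lambda>n. bump n c d x) \<longlonglongrightarrow> indicator {c<..<d} x"
proof -
  have "(\<lambda>n. bump n c d x) \<longlonglongrightarrow> (if x - c > 0 then 1 else 0) * (if d - x > 0 then 1 else 0)"
    unfolding bump_def by (intro tendsto_mult flat_exp_1_tendsto)
  then show ?thesis by (auto simp: indicator_def split: if_splits)
qed

section \<open>Integrals and primitives on a compact interval\<close>

text \<open>
  With this rule the measurability prover treats indicators of Borel sets as functions on \<open>lebesgue_on S\<close>.
\<close>

lemma borel_measurable_ident_lebesgue_on [measurable]: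
  "(\<lambda>x::real. x) \<in> borel_measurable (lebesgue_on S)"
  by (intro measurable_restrict_space1 measurable_completion) simp

lemma continuous_on_measurable_Icc:
  "continuous_on {a..b} h \<Longrightarrow> h \<in> borel_measurable (lebesgue_on {a..b})" for a b :: real
  by (rule continuous_imp_measurable_on_sets_lebesgue) auto

lemma continuous_on_integrable_Icc:
  "continuous_on {a..b} h \<Longrightarrow> integrable (lebesgue_on {a..b}) h" for h :: "real \<Rightarrow> real"
  using continuous_imp_integrable[of a b h] by simp

lemma integrable_Icc_continuous_mult:
  fixes f h :: "real \<Rightarrow> real"
  assumes f: "integrable (lebesgue_on {a..b}) f" and h: "continuous_on {a..b} h"
  shows "integrable (lebesgue_on {a..b}) (\<lambda>x. h x * f x)"
proof -
  have "bounded (h ` {a..b})"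
    using h by (intro compact_imp_bounded compact_continuous_image) auto
  then obtain C where C: "\<forall>x\<in>{a..b}. \<bar>h x\<bar> \<le> C"
    by (auto simp: bounded_iff)
  show ?thesis
  proof (rule Bochner_Integration.integrable_bound)
    show "integrable (lebesgue_on {a..b}) (\<lambda>x. C * f x)" using f by simp
    show "(\<lambda>x. h x * f x) \<in> borel_measurable (lebesgue_on {a..b})"
      using f continuous_on_measurable_Icc[OF h] by measurable
    show "AE x in lebesgue_on {a..b}. norm (h x * f x) \<le> norm (C * f x)"
      using C by (intro AE_I2)
        (simp add: abs_mult mult_right_mono order_trans[OF _ abs_ge_self])
  qed
qed

lemma integrable_Icc_indicator:
  fixes f :: "real \<Rightarrow> real"
  assumes f: "integrable (lebesgue_on {a..b}) f" and S: "S \<in> sets borel"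
  shows "integrable (lebesgue_on {a..b}) (\<lambda>x. indicator S x * f x)"
proof (rule Bochner_Integration.integrable_bound[OF f])
  note S [measurable]
  show "(\<lambda>x. indicator S x * f x) \<in> borel_measurable (lebesgue_on {a..b})"
    using f by measurable
qed (auto simp: indicator_def)

lemma integral_indicator_Icc:
  fixes f :: "real \<Rightarrow> real"
  assumes f: "integrable (lebesgue_on {a..b}) f" and S: "S \<in> sets borel" "S \<inter> {a..b} = {c..d}"
  shows "(LINT x|lebesgue_on {a..b}. indicator S x * f x) = integral {c..d} f"
proof -
  have "(LINT x|lebesgue_on {a..b}. indicator S x * f x) = integral {a..b} (\<lambda>x. indicator S x * f x)"
    using integrable_Icc_indicator[OF f S(1)] by (intro lebesgue_integral_eq_integral) auto
  also have "\<dots> = integral {a..b} (\<lambda>x. if x \<in> S then f x else 0)"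
    by (intro Henstock_Kurzweil_Integration.integral_cong) (auto simp: indicator_def)
  also have "\<dots> = integral {c..d} f"
    by (simp add: Henstock_Kurzweil_Integration.integral_restrict_Int S)
  finally show ?thesis .
qed

lemma integrable_Icc_HK:
  fixes f :: "real \<Rightarrow> real"
  shows "integrable (lebesgue_on {a..b}) f \<Longrightarrow> f integrable_on {a..b}"
  by (rule integrable_on_lebesgue_on) auto

lemma integral_Icc_HK:
  fixes f :: "real \<Rightarrow> real"
  shows "integrable (lebesgue_on {a..b}) f \<Longrightarrow> integral\<^sup>L (lebesgue_on {a..b}) f = integral {a..b} f"
  by (rule lebesgue_integral_eq_integral) auto

lemma continuous_on_primitive:
  fixes f :: "real \<Rightarrow> real"
  shows "integrable (lebesgue_on {a..b}) f \<Longrightarrow> continuous_on {a..b} (\<lambda>x. integral {a..x} f)"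
  by (intro indefinite_integral_continuous_1 integrable_Icc_HK)

text \<open>
  The primitives need not be differentiable at every point, which rules out the product rule.
  Instead, the identity is read off from the double integral of \<open>f t * k x\<close> over the triangle
  \<open>x \<le> t\<close>: integrating in \<open>x\<close> first gives the primitive of \<open>k\<close>, and integrating in \<open>t\<close> first
  gives the total integral of \<open>f\<close> minus its primitive.
\<close>

lemma integral_by_parts_primitives:
  fixes f k :: "real \<Rightarrow> real"
  assumes f: "integrable (lebesgue_on {a..b}) f" and k: "integrable (lebesgue_on {a..b}) k"
  shows "(LINT x|lebesgue_on {a..b}. integral {a..x} f * k x)
           + (LINT x|lebesgue_on {a..b}. f x * integral {a..x} k)
         = integral {a..b} f * integral {a..b} k"
proof -
  let ?M = "lebesgue_on {a..b}"
  interpret finite_measure ?M by (intro finite_measure_lebesgue_on) auto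
  interpret pair_sigma_finite ?M ?M ..
  have [measurable]: "f \<in> borel_measurable ?M" "k \<in> borel_measurable ?M" using f k by auto
  let ?g = "\<lambda>t x. (if x \<le> t then f t * k x else 0)"
  have "integrable (?M \<Otimes>\<^sub>M ?M) (\<lambda>p. f (fst p) * k (snd p))"
    using f k by (intro Fubini_integrable) (auto simp: abs_mult)
  then have "integrable (?M \<Otimes>\<^sub>M ?M) (case_prod ?g)"
    by (rule Bochner_Integration.integrable_bound) (auto simp: split_beta)
  from Fubini_integral[OF this]
  have "(LINT x|?M. LINT t|?M. ?g t x) = (LINT t|?M. LINT x|?M. ?g t x)" .
  moreover have "(LINT x|?M. LINT t|?M. ?g t x) = (LINT x|?M. k x * integral {x..b} f)"
  proof (rule Bochner_Integration.integral_cong[OF refl])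
    fix x assume "x \<in> space ?M"
    then have "(LINT t|?M. indicator {x..} t * f t) = integral {x..b} f"
      by (intro integral_indicator_Icc f) auto
    moreover have "(LINT t|?M. ?g t x) = (LINT t|?M. k x * (indicator {x..} t * f t))"
      by (intro Bochner_Integration.integral_cong) (auto simp: indicator_def)
    ultimately show "(LINT t|?M. ?g t x) = k x * integral {x..b} f" by simp
  qed
  moreover have "(LINT t|?M. LINT x|?M. ?g t x) = (LINT t|?M. f t * integral {a..t} k)"
  proof (rule Bochner_Integration.integral_cong[OF refl])
    fix t assume "t \<in> space ?M"
    then have "(LINT x|?M. indicator {..t} x * k x) = integral {a..t} k"
      by (intro integral_indicator_Icc k) auto
    moreover have "(LINT x|?M. ?g t x) = (LINT x|?M. f t * (indicator {..t} x * k x))"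
      by (intro Bochner_Integration.integral_cong) (auto simp: indicator_def)
    ultimately show "(LINT x|?M. ?g t x) = f t * integral {a..t} k" by simp
  qed
  moreover have "(LINT x|?M. k x * integral {x..b} f)
      = (LINT x|?M. k x * integral {a..b} f - integral {a..x} f * k x)"
  proof (rule Bochner_Integration.integral_cong[OF refl])
    fix x assume "x \<in> space ?M"
    then have "integral {a..x} f + integral {x..b} f = integral {a..b} f"
      using integrable_Icc_HK[OF f] by (intro Henstock_Kurzweil_Integration.integral_combine) auto
    then show "k x * integral {x..b} f = k x * integral {a..b} f - integral {a..x} f * k x"
      by (simp add: algebra_simps flip: \<open>_ = integral {a..b} f\<close>)
  qed
  moreover have "(LINT x|?M. k x * integral {a..b} f - integral {a..x} f * k x)
      = integral {a..b} f * integral {a..b} k - (LINT x|?M. integral {a..x} f * k x)"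
    using k integrable_Icc_continuous_mult[OF k continuous_on_primitive[OF f]]
    by (simp add: integral_Icc_HK)
  ultimately show ?thesis by simp
qed

lemma L2_D:
  assumes "f \<in> L2 a b"
  shows "f \<in> borel_measurable (lebesgue_on {a..b})" "integrable (lebesgue_on {a..b}) (\<lambda>x. (f x)\<^sup>2)"
    "integrable (lebesgue_on {a..b}) f"
proof -
  interpret finite_measure "lebesgue_on {a..b}" by (intro finite_measure_lebesgue_on) auto
  show m: "f \<in> borel_measurable (lebesgue_on {a..b})" "integrable (lebesgue_on {a..b}) (\<lambda>x. (f x)\<^sup>2)"
    using assms by (auto simp: L2_def)
  then show "integrable (lebesgue_on {a..b}) f" by (rule square_integrable_imp_integrable)
qed

lemma L2_mult_integrable:
  assumes "f \<in> L2 a b" "g \<in> L2 a b"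
  shows "integrable (lebesgue_on {a..b}) (\<lambda>x. f x * g x)"
proof (rule Bochner_Integration.integrable_bound)
  note L2_D[OF assms(1), measurable] L2_D[OF assms(2), measurable]
  show "integrable (lebesgue_on {a..b}) (\<lambda>x. (f x)\<^sup>2 + (g x)\<^sup>2)"
    using assms by (intro Bochner_Integration.integrable_add L2_D)
  show "(\<lambda>x. f x * g x) \<in> borel_measurable (lebesgue_on {a..b})" by measurable
  have "\<bar>f x * g x\<bar> \<le> (f x)\<^sup>2 + (g x)\<^sup>2" for x
  proof -
    have "2 * (\<bar>f x\<bar> * \<bar>g x\<bar>) \<le> (f x)\<^sup>2 + (g x)\<^sup>2"
      using sum_squares_bound[of "\<bar>f x\<bar>" "\<bar>g x\<bar>"] by simp
    moreover have "0 \<le> \<bar>f x\<bar> * \<bar>g x\<bar>" by simp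
    ultimately show ?thesis unfolding abs_mult by linarith
  qed
  then show "AE x in lebesgue_on {a..b}. norm (f x * g x) \<le> norm ((f x)\<^sup>2 + (g x)\<^sup>2)"
    by (intro AE_I2) simp
qed

lemma L2_cmult: "f \<in> L2 a b \<Longrightarrow> (\<lambda>x. c * f x) \<in> L2 a b"
  by (auto simp: L2_def power_mult_distrib)

lemma L2_add:
  assumes "f \<in> L2 a b" "g \<in> L2 a b"
  shows "(\<lambda>x. f x + g x) \<in> L2 a b"
  using assms L2_mult_integrable[OF assms] by (auto simp: L2_def power2_sum mult.assoc)

lemma L2_uminus: "f \<in> L2 a b \<Longrightarrow> (\<lambda>x. - f x) \<in> L2 a b"
  by (auto simp: L2_def)

lemma L2_diff:
  assumes "f \<in> L2 a b" "g \<in> L2 a b"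
  shows "(\<lambda>x. f x - g x) \<in> L2 a b"
  using L2_add[OF assms(1) L2_uminus[OF assms(2)]] by simp

lemma L2_continuous: "continuous_on {a..b} f \<Longrightarrow> f \<in> L2 a b"
  by (auto simp: L2_def intro!: continuous_on_measurable_Icc continuous_on_integrable_Icc continuous_intros)

section \<open>Test functions and the fundamental lemmas of the calculus of variations\<close>

lemma test_functions_iff:
  "\<eta> \<in> test_functions a b \<longleftrightarrow> (\<forall>n. differentiable_upto n \<eta>) \<and>
     (\<exists>c d. a < c \<and> d < b \<and> (\<forall>x. x \<notin> {c..d} \<longrightarrow> \<eta> x = 0))"
  by (simp add: test_functions_def all_derivs_differentiable_iff)

lemma test_function_differentiable: "\<eta> \<in> test_functions a b \<Longrightarrow> \<eta> differentiable (at x)"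
  using differentiable_upto_imp_differentiable by (auto simp: test_functions_iff)

lemma test_function_has_deriv:
  "\<eta> \<in> test_functions a b \<Longrightarrow> (\<eta> has_real_derivative deriv \<eta> x) (at x within S)"
  by (rule has_field_derivative_at_within[OF differentiable_imp_has_deriv[OF test_function_differentiable]])

lemma test_function_continuous: "\<eta> \<in> test_functions a b \<Longrightarrow> continuous_on S \<eta>"
  using test_function_has_deriv by (auto intro!: DERIV_continuous_on)

lemma test_function_boundary: "\<eta> \<in> test_functions a b \<Longrightarrow> \<eta> a = 0 \<and> \<eta> b = 0"
  by (fastforce simp: test_functions_iff)

lemma test_function_deriv:
  assumes "\<eta> \<in> test_functions a b"
  shows "deriv \<eta> \<in> test_functions a b"
proof -
  from assms obtain c d where cd: "a < c" "d < b" "\<And>x. x \<notin> {c..d} \<Longrightarrow> \<eta> x = 0"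
    and sm: "\<And>n. differentiable_upto n \<eta>"
    by (auto simp: test_functions_iff)
  have "deriv \<eta> x = 0" if "x \<notin> {c..d}" for x
  proof (rule DERIV_imp_deriv)
    show "(\<eta> has_real_derivative 0) (at x)"
      by (rule has_field_derivative_transform_within_open[of "\<lambda>_. 0" _ _ "- {c..d}"])
         (use that cd(3) in \<open>auto simp: open_Compl\<close>)
  qed
  moreover have "differentiable_upto n (deriv \<eta>)" for n
    using sm[of "Suc n"] by simp
  ultimately show ?thesis
    using cd(1,2) unfolding test_functions_iff by blast
qed

lemma test_function_add_scaled:
  assumes "\<eta> \<in> test_functions a b" "\<rho> \<in> test_functions a b"
  shows "(\<lambda>x. \<eta> x + r * \<rho> x) \<in> test_functions a b"
proof -
  from assms obtain c d c' d' where
    cd: "a < c" "d < b" "\<And>x. x \<notin> {c..d} \<Longrightarrow> \<eta> x = 0" and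
    cd': "a < c'" "d' < b" "\<And>x. x \<notin> {c'..d'} \<Longrightarrow> \<rho> x = 0"
    unfolding test_functions_iff by metis
  have "\<eta> x + r * \<rho> x = 0" if "x \<notin> {min c c'..max d d'}" for x
  proof -
    have "\<eta> x = 0" "\<rho> x = 0" using that by (auto intro!: cd(3) cd'(3))
    then show ?thesis by simp
  qed
  with cd cd' have "a < min c c'" "max d d' < b"
    "\<forall>x. x \<notin> {min c c'..max d d'} \<longrightarrow> \<eta> x + r * \<rho> x = 0"
    by auto
  moreover have "differentiable_upto n (\<lambda>x. \<eta> x + r * \<rho> x)" for n
    using assms
    by (intro differentiable_upto_add differentiable_upto_mult differentiable_upto_const)
       (auto simp: test_functions_iff)
  ultimately show ?thesis unfolding test_functions_iff by blast
qed

lemma test_function_eq_primitive: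
  assumes \<eta>: "\<eta> \<in> test_functions a b" and x: "a \<le> x"
  shows "integral {a..x} (deriv \<eta>) = \<eta> x"
proof -
  have "(deriv \<eta> has_integral (\<eta> x - \<eta> a)) {a..x}"
    using x test_function_has_deriv[OF \<eta>]
    by (intro fundamental_theorem_of_calculus) (auto simp: has_real_derivative_iff_has_vector_derivative)
  then show ?thesis using test_function_boundary[OF \<eta>] by (simp add: integral_unique)
qed

text \<open>
  Vanishing total integral is what makes the primitive from \<open>a\<close> return to 0 to the right of the
  support, so that it is again compactly supported.
\<close>

lemma test_function_primitive:
  assumes \<theta>: "\<theta> \<in> test_functions a b" and int0: "integral {a..b} \<theta> = 0"
  obtains \<zeta> where "\<zeta> \<in> test_functions a b" "deriv \<zeta> = \<theta>"
proof -
  from \<theta> obtain c d where cd: "a < c" "d < b" "\<And>x. x \<notin> {c..d} \<Longrightarrow> \<theta> x = 0"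
    by (auto simp: test_functions_iff)
  \<comment> \<open>The right end of the support is moved strictly beyond \<open>d\<close>, so that the integrand vanishes on all of \<open>{e..}\<close>.\<close>
  define e where "e = max a ((d + b) / 2)"
  define \<zeta> where "\<zeta> x = integral {a..x} \<theta>" for x
  have left: "\<zeta> x = 0" if "x < c" for x
  proof -
    have "\<zeta> x = integral {a..x} (\<lambda>_. 0)"
      unfolding \<zeta>_def using that cd(3) by (intro Henstock_Kurzweil_Integration.integral_cong) auto
    then show ?thesis by simp
  qed
  have right': "\<zeta> x = \<zeta> e" if "e \<le> x" for x
  proof -
    have "\<zeta> e + integral {e..x} \<theta> = \<zeta> x"
      unfolding \<zeta>_def using that
      by (intro Henstock_Kurzweil_Integration.integral_combine)
         (auto simp: e_def intro!: integrable_continuous_real test_function_continuous[OF \<theta>])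
    moreover have "integral {e..x} \<theta> = integral {e..x} (\<lambda>_. 0)"
      using cd(2,3) by (intro Henstock_Kurzweil_Integration.integral_cong) (auto simp: e_def max_def split: if_splits)
    ultimately show ?thesis by simp
  qed
  show ?thesis
  proof (cases "a < b")
    case False
    then have "\<theta> = (\<lambda>x. 0)" using cd by (auto simp: fun_eq_iff)
    then show ?thesis using that[of "\<lambda>x. 0"] \<theta> by simp
  next
    case True
    then have e: "e < b" "a \<le> e" "d < e" using cd by (auto simp: e_def less_max_iff_disj)
    have right: "\<zeta> x = 0" if "e \<le> x" for x
      using right'[OF that] right'[of b] e int0 by (simp add: \<zeta>_def)
    have D: "(\<zeta> has_real_derivative \<theta> x) (at x)" for x
    proof (cases "a < x")
      case True
      have "(\<zeta> has_real_derivative \<theta> x) (at x within {a..x+1})"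
        unfolding \<zeta>_def using True
        by (intro integral_has_real_derivative test_function_continuous[OF \<theta>]) auto
      then show ?thesis using True by (simp add: at_within_Icc_at)
    next
      case False
      then have "\<theta> x = 0" using cd by auto
      have "(\<zeta> has_real_derivative 0) (at x)"
        by (rule has_field_derivative_transform_within_open[of "\<lambda>_. 0" _ _ "{..<c}"])
           (use False cd(1) left in auto)
      then show ?thesis by (simp add: \<open>\<theta> x = 0\<close>)
    qed
    then have d: "deriv \<zeta> = \<theta>" by (auto intro!: DERIV_imp_deriv)
    have "differentiable_upto n \<zeta>" for n
      using D \<theta> d by (cases n) (auto simp: real_differentiable_def test_functions_iff)
    moreover have "\<forall>x. x \<notin> {c..e} \<longrightarrow> \<zeta> x = 0" using left right by auto
    ultimately have "\<zeta> \<in> test_functions a b"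
      unfolding test_functions_iff using cd(1) e(1) by blast
    with d show ?thesis using that by blast
  qed
qed

lemma integrable_mult_test:
  assumes "integrable (lebesgue_on {a..b}) f" "\<eta> \<in> test_functions a b"
  shows "integrable (lebesgue_on {a..b}) (\<lambda>x. f x * \<eta> x)"
  using integrable_Icc_continuous_mult[OF assms(1) test_function_continuous[OF assms(2)]]
  by (simp add: mult.commute)

text \<open>
  This is what makes an absolutely continuous function weakly differentiable: the boundary
  terms of the integration by parts vanish against a test function.
\<close>

lemma integral_primitive_mult_deriv_test:
  assumes f: "integrable (lebesgue_on {a..b}) f" and \<eta>: "\<eta> \<in> test_functions a b" and ab: "a \<le> b"
  shows "(LINT x|lebesgue_on {a..b}. (C + integral {a..x} f) * deriv \<eta> x)
       = - (LINT x|lebesgue_on {a..b}. f x * \<eta> x)"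
proof -
  let ?M = "lebesgue_on {a..b}"
  have d: "integrable ?M (deriv \<eta>)"
    by (intro continuous_on_integrable_Icc test_function_continuous[OF test_function_deriv[OF \<eta>]])
  have "(LINT x|?M. integral {a..x} f * deriv \<eta> x) + (LINT x|?M. f x * integral {a..x} (deriv \<eta>)) = 0"
    using integral_by_parts_primitives[OF f d] test_function_eq_primitive[OF \<eta> ab]
      test_function_boundary[OF \<eta>] by simp
  moreover have "(LINT x|?M. f x * integral {a..x} (deriv \<eta>)) = (LINT x|?M. f x * \<eta> x)"
    by (intro Bochner_Integration.integral_cong) (auto simp: test_function_eq_primitive[OF \<eta>])
  moreover have "(LINT x|?M. deriv \<eta> x) = 0"
    using test_function_eq_primitive[OF \<eta> ab] test_function_boundary[OF \<eta>] by (simp add: integral_Icc_HK[OF d])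
  moreover have "(LINT x|?M. (C + integral {a..x} f) * deriv \<eta> x)
      = C * (LINT x|?M. deriv \<eta> x) + (LINT x|?M. integral {a..x} f * deriv \<eta> x)"
    using d integrable_mult_test[OF continuous_on_integrable_Icc[OF continuous_on_primitive[OF f]] test_function_deriv[OF \<eta>]]
    by (simp add: distrib_right)
  ultimately show ?thesis by simp
qed

text \<open>
  By Lebesgue differentiation, almost every value of \<open>v\<close> is a limit of means of \<open>v\<close> over
  shrinking intervals, and all those means are 0.
\<close>

lemma AE_zero_if_subinterval_integrals_zero:
  fixes v :: "real \<Rightarrow> real"
  assumes v: "integrable (lebesgue_on {a..b}) v"
    and 0: "\<And>c d. a < c \<Longrightarrow> c < d \<Longrightarrow> d < b \<Longrightarrow> integral {c..d} v = 0"
  shows "AE x in lebesgue_on {a..b}. v x = 0"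
proof -
  define f where "f x = (if x \<in> {a..b} then v x else 0)" for x
  have "f integrable_on UNIV"
    unfolding f_def using integrable_Icc_HK[OF v] by (simp only: Henstock_Kurzweil_Integration.integrable_restrict_UNIV)
  then have "f integrable_on cbox c d" for c d
    by (rule integrable_on_subcbox) auto
  then obtain N where N: "negligible N"
    "\<And>x e. x \<notin> N \<Longrightarrow> 0 < e \<Longrightarrow> \<exists>d>0. \<forall>h. 0 < h \<and> h < d \<longrightarrow>
        norm (integral (cbox x (x + h *\<^sub>R One)) f /\<^sub>R h ^ DIM(real) - f x) < e"
    by (rule integrable_ccontinuous_explicit) blast
  have "v x = 0" if x: "a < x" "x < b" "x \<notin> N" for x
  proof (rule ccontr)
    assume "v x \<noteq> 0"
    with N(2)[OF x(3), of "\<bar>v x\<bar>"] obtain d where d: "d > 0"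
      "\<And>h. 0 < h \<Longrightarrow> h < d \<Longrightarrow> norm (integral (cbox x (x + h *\<^sub>R One)) f /\<^sub>R h ^ DIM(real) - f x) < \<bar>v x\<bar>"
      by auto
    obtain h where h: "0 < h" "h < d" "h < b - x"
      using field_lbound_gt_zero[of d "b - x"] d(1) x by auto
    have "integral {x..x+h} f = integral {x..x+h} v"
      by (intro Henstock_Kurzweil_Integration.integral_cong) (use x h in \<open>auto simp: f_def\<close>)
    also have "\<dots> = 0" using h x by (intro 0) auto
    finally show False using d(2)[OF h(1,2)] x by (auto simp: f_def)
  qed
  then have "{x. \<not> (x \<in> {a..b} \<longrightarrow> v x = 0)} \<subseteq> N \<union> {a, b}" by force
  moreover have "negligible (N \<union> {a, b})" using N(1) by (intro negligible_Un) auto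
  ultimately have "AE x in lebesgue. x \<in> {a..b} \<longrightarrow> v x = 0"
    unfolding eventually_ae_filter_negligible by blast
  then show ?thesis by (subst AE_restrict_space_iff) auto
qed

text \<open>
  Testing against bumps that converge boundedly to the indicator of an interval gives vanishing
  integrals over all intervals, by dominated convergence.
\<close>

lemma fundamental_lemma_calculus_of_variations:
  fixes v :: "real \<Rightarrow> real"
  assumes v: "integrable (lebesgue_on {a..b}) v"
    and orth: "\<And>\<eta>. \<eta> \<in> test_functions a b \<Longrightarrow> (LINT x|lebesgue_on {a..b}. v x * \<eta> x) = 0"
  shows "AE x in lebesgue_on {a..b}. v x = 0"
proof (rule AE_zero_if_subinterval_integrals_zero[OF v])
  fix c d assume cd: "a < c" "c < d" "d < b"
  let ?M = "lebesgue_on {a..b}"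
  have t: "bump n c d \<in> test_functions a b" for n using cd by (intro bump_test_function)
  have "(\<lambda>n. LINT x|?M. v x * bump n c d x) \<longlonglongrightarrow> (LINT x|?M. v x * indicator {c<..<d} x)"
  proof (rule integral_dominated_convergence)
    show "integrable ?M (\<lambda>x. \<bar>v x\<bar>)" using v by simp
    show "(\<lambda>x. v x * bump n c d x) \<in> borel_measurable ?M" for n
      using integrable_mult_test[OF v t] by auto
    show "(\<lambda>x. v x * indicator {c<..<d} x) \<in> borel_measurable ?M"
      using v by measurable
    show "AE x in ?M. (\<lambda>n. v x * bump n c d x) \<longlonglongrightarrow> v x * indicator {c<..<d} x"
      by (intro AE_I2 tendsto_mult tendsto_const bump_tendsto_indicator)
    show "AE x in ?M. norm (v x * bump n c d x) \<le> \<bar>v x\<bar>" for n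
      using bump_bounds by (intro AE_I2) (simp add: abs_mult mult_left_le)
  qed
  then have "(LINT x|?M. v x * indicator {c<..<d} x) = 0"
    using orth[OF t] by (simp add: LIMSEQ_const_iff)
  moreover have "(LINT x|?M. v x * indicator {c<..<d} x) = (LINT x|?M. indicator {c..d} x * v x)"
  proof (rule integral_cong_AE)
    have "AE x in lebesgue. x \<notin> {c, d}"
      unfolding eventually_ae_filter_negligible by (rule exI[of _ "{c, d}"]) auto
    then have "AE x in ?M. x \<notin> {c, d}" by (subst AE_restrict_space_iff) auto
    then show "AE x in ?M. v x * indicator {c<..<d} x = indicator {c..d} x * v x"
      by eventually_elim (auto simp: indicator_def)
  qed (use v in measurable)
  moreover have "\<dots> = integral {c..d} v"
    using cd by (intro integral_indicator_Icc v) auto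
  ultimately show "integral {c..d} v = 0" by simp
qed

text \<open>
  Fix a test function \<open>\<rho>\<close> of nonzero integral \<open>I\<close>. Subtracting from a test function \<open>\<eta>\<close> the
  multiple of \<open>\<rho>\<close> with the same integral leaves a derivative of a test function. Orthogonality to
  derivatives therefore says that \<open>v\<close> minus its \<open>\<rho>\<close>-mean is orthogonal to every \<open>\<eta>\<close>.
\<close>

lemma du_Bois_Reymond:
  fixes v :: "real \<Rightarrow> real"
  assumes ab: "a < b" and v: "integrable (lebesgue_on {a..b}) v"
    and orth: "\<And>\<eta>. \<eta> \<in> test_functions a b \<Longrightarrow> (LINT x|lebesgue_on {a..b}. v x * deriv \<eta> x) = 0"
  obtains C where "AE x in lebesgue_on {a..b}. v x = C"
proof -
  let ?M = "lebesgue_on {a..b}"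
  define \<rho> where "\<rho> = bump 0 ((2 * a + b) / 3) ((a + 2 * b) / 3)"
  have \<rho>: "\<rho> \<in> test_functions a b" unfolding \<rho>_def using ab by (intro bump_test_function) auto
  define I where "I = integral {a..b} \<rho>"
  have "I \<noteq> 0"
  proof
    assume "I = 0"
    then have "\<rho> ((a + b) / 2) = 0"
      using ab bump_bounds integral_eq_0_iff[OF test_function_continuous[OF \<rho>] ab]
      by (auto simp: I_def \<rho>_def)
    then show False using ab by (simp add: \<rho>_def bump_def flat_exp_def field_simps split: if_splits)
  qed
  have tint: "integrable ?M \<eta>" if "\<eta> \<in> test_functions a b" for \<eta>
    using that by (intro continuous_on_integrable_Icc test_function_continuous)
  define C where "C = (LINT x|?M. v x * \<rho> x) / I"
  have "(LINT x|?M. (v x - C) * \<eta> x) = 0" if \<eta>: "\<eta> \<in> test_functions a b" for \<eta>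
  proof -
    define J where "J = integral {a..b} \<eta>"
    define \<theta> where "\<theta> = (\<lambda>x. \<eta> x + (- J / I) * \<rho> x)"
    have \<theta>: "\<theta> \<in> test_functions a b" unfolding \<theta>_def by (intro test_function_add_scaled \<eta> \<rho>)
    have "integral {a..b} \<theta> = J + (- J / I) * I"
      unfolding \<theta>_def using tint[OF \<eta>] tint[OF \<rho>]
      by (simp add: I_def J_def flip: integral_Icc_HK)
    then have "integral {a..b} \<theta> = 0" using \<open>I \<noteq> 0\<close> by simp
    then obtain \<zeta> where "\<zeta> \<in> test_functions a b" "deriv \<zeta> = \<theta>"
      using test_function_primitive[OF \<theta>] by blast
    then have "0 = (LINT x|?M. v x * \<theta> x)" using orth by auto
    also have "\<dots> = (LINT x|?M. v x * \<eta> x + (- J / I) * (v x * \<rho> x))"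
      by (simp add: \<theta>_def algebra_simps)
    also have "\<dots> = (LINT x|?M. v x * \<eta> x) - C * J"
      using integrable_mult_test[OF v \<eta>] integrable_mult_test[OF v \<rho>] by (simp add: C_def)
    also have "\<dots> = (LINT x|?M. (v x - C) * \<eta> x)"
      using integrable_mult_test[OF v \<eta>] tint[OF \<eta>]
      by (simp add: left_diff_distrib J_def integral_Icc_HK)
    finally show ?thesis by simp
  qed
  then have "AE x in ?M. v x - C = 0"
    using v by (intro fundamental_lemma_calculus_of_variations) auto
  then show ?thesis using that[of C] by simp
qed

section \<open>Weak derivatives\<close>

lemma test_function_deriv_funpow:
  "\<eta> \<in> test_functions a b \<Longrightarrow> (deriv ^^ n) \<eta> \<in> test_functions a b"
  by (induction n) (auto intro: test_function_deriv)

lemma has_weak_deriv_diff: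
  assumes f: "f \<in> L2 a b" "has_weak_deriv a b n f v" and g: "g \<in> L2 a b" "has_weak_deriv a b n g w"
  shows "has_weak_deriv a b n (\<lambda>x. f x - g x) (\<lambda>x. v x - w x)"
  using assms integrable_mult_test[OF L2_D(3)] test_function_deriv_funpow
  by (auto simp: has_weak_deriv_def L2_diff left_diff_distrib right_diff_distrib)

lemma integral_mult_test_cong_L2_eq:
  assumes "v \<in> L2 a b" "w \<in> L2 a b" "L2_eq a b v w" "\<eta> \<in> test_functions a b"
  shows "(LINT x|lebesgue_on {a..b}. v x * \<eta> x) = (LINT x|lebesgue_on {a..b}. w x * \<eta> x)"
proof (rule integral_cong_AE)
  show "AE x in lebesgue_on {a..b}. v x * \<eta> x = w x * \<eta> x"
    using assms(3) unfolding L2_eq_def by eventually_elim simp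
qed (use assms integrable_mult_test[OF L2_D(3)] in auto)

lemma has_weak_deriv_cong:
  assumes "has_weak_deriv a b n f v" "L2_eq a b v w" "w \<in> L2 a b"
  shows "has_weak_deriv a b n f w"
  using assms integral_mult_test_cong_L2_eq[of v a b w] by (auto simp: has_weak_deriv_def)

lemma has_weak_deriv_unique:
  assumes "has_weak_deriv a b n f v" "has_weak_deriv a b n f w"
  shows "L2_eq a b v w"
proof -
  have vw: "v \<in> L2 a b" "w \<in> L2 a b" using assms by (auto simp: has_weak_deriv_def)
  have "AE x in lebesgue_on {a..b}. v x - w x = 0"
  proof (rule fundamental_lemma_calculus_of_variations)
    show "integrable (lebesgue_on {a..b}) (\<lambda>x. v x - w x)" using vw by (intro L2_D L2_diff)
    fix \<eta> assume \<eta>: "\<eta> \<in> test_functions a b"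
    then have "(-1) ^ n * (LINT x|lebesgue_on {a..b}. v x * \<eta> x)
             = (-1) ^ n * (LINT x|lebesgue_on {a..b}. w x * \<eta> x)"
      using assms by (simp add: has_weak_deriv_def)
    then show "(LINT x|lebesgue_on {a..b}. (v x - w x) * \<eta> x) = 0"
      using integrable_mult_test[OF L2_D(3) \<eta>] vw by (simp add: left_diff_distrib)
  qed
  then show ?thesis by (simp add: L2_eq_def)
qed

lemma has_weak_deriv_weak_deriv: "has_weak_deriv a b n f v \<Longrightarrow> has_weak_deriv a b n f (weak_deriv a b n f)"
  unfolding weak_deriv_def by (rule someI[of "has_weak_deriv a b n f"])

lemma weak_deriv_L2_eq: "has_weak_deriv a b n f v \<Longrightarrow> L2_eq a b (weak_deriv a b n f) v"
  using has_weak_deriv_weak_deriv has_weak_deriv_unique by blast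

text \<open>
  The derivative of a test function is a test function, so testing the first weak derivative
  against \<open>deriv \<eta>\<close> turns the second-order identity for \<open>f\<close> into a first-order one for \<open>v\<close>.
\<close>

lemma has_weak_deriv_second_imp_first:
  assumes "has_weak_deriv a b 1 f v" "has_weak_deriv a b 2 f w"
  shows "has_weak_deriv a b 1 v w"
  using assms test_function_deriv[of _ a b]
  by (auto simp: has_weak_deriv_def numeral_2_eq_2)

lemma has_weak_deriv_primitive:
  assumes f: "f \<in> L2 a b" and ab: "a \<le> b"
  shows "has_weak_deriv a b 1 (\<lambda>x. C + integral {a..x} f) f"
  using f integral_primitive_mult_deriv_test[OF L2_D(3)[OF f] _ ab] by (simp add: has_weak_deriv_def)

lemma has_weak_deriv_zero_imp_const:
  assumes "a < b" "f \<in> L2 a b" "has_weak_deriv a b 1 f (\<lambda>x. 0)"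
  obtains C where "AE x in lebesgue_on {a..b}. f x = C"
  using du_Bois_Reymond[OF assms(1) L2_D(3)[OF assms(2)]] assms(3) by (auto simp: has_weak_deriv_def)

lemma continuous_AE_const_imp_const:
  fixes f :: "real \<Rightarrow> real"
  assumes f: "continuous_on {a..b} f" and "a < b" and AE: "AE x in lebesgue_on {a..b}. f x = C"
    and x: "x \<in> {a..b}"
  shows "f x = C"
proof -
  have c: "continuous_on {a..b} (\<lambda>x. (f x - C)\<^sup>2)" using f by (intro continuous_intros)
  have "AE x in lebesgue_on {a..b}. (f x - C)\<^sup>2 = 0" using AE by eventually_elim simp
  then have "(LINT x|lebesgue_on {a..b}. (f x - C)\<^sup>2) = 0" by (rule integral_eq_zero_AE)
  then have "integral {a..b} (\<lambda>x. (f x - C)\<^sup>2) = 0"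
    by (simp add: integral_Icc_HK continuous_on_integrable_Icc[OF c])
  then show ?thesis using integral_eq_0_iff[OF c \<open>a < b\<close>] x by auto
qed

section \<open>The Dirichlet problem\<close>

text \<open>
  Integrating \<open>- y'' = f\<close> once gives \<open>y' = c - \<integral>\<^sub>a\<^sup>x f\<close>; the constant \<open>c\<close> chosen here is the one for
  which \<open>y'\<close> has mean 0 on \<open>{a..b}\<close>, that is, for which the primitive of \<open>y'\<close> from \<open>a\<close> also
  vanishes at \<open>b\<close>.
\<close>

definition dirichlet_slope :: "real \<Rightarrow> real \<Rightarrow> (real \<Rightarrow> real) \<Rightarrow> real \<Rightarrow> real" where
  "dirichlet_slope a b f x =
     integral {a..b} (\<lambda>s. integral {a..s} f) / (b - a) - integral {a..x} f"

definition dirichlet_solution :: "real \<Rightarrow> real \<Rightarrow> (real \<Rightarrow> real) \<Rightarrow> real \<Rightarrow> real" where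
  "dirichlet_solution a b f x = integral {a..x} (dirichlet_slope a b f)"

lemma dirichlet_slope_continuous:
  "f \<in> L2 a b \<Longrightarrow> continuous_on {a..b} (dirichlet_slope a b f)"
  unfolding dirichlet_slope_def
  by (rule continuous_on_diff[OF continuous_on_const continuous_on_primitive[OF L2_D(3)]])

lemma dirichlet_slope_L2: "f \<in> L2 a b \<Longrightarrow> dirichlet_slope a b f \<in> L2 a b"
  by (rule L2_continuous[OF dirichlet_slope_continuous])

lemma dirichlet_solution_continuous:
  "f \<in> L2 a b \<Longrightarrow> continuous_on {a..b} (dirichlet_solution a b f)"
  unfolding dirichlet_solution_def by (rule continuous_on_primitive[OF L2_D(3)[OF dirichlet_slope_L2]])

lemma dirichlet_solution_L2: "f \<in> L2 a b \<Longrightarrow> dirichlet_solution a b f \<in> L2 a b"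
  by (rule L2_continuous[OF dirichlet_solution_continuous])

lemma dirichlet_solution_boundary:
  assumes "a < b" "f \<in> L2 a b"
  shows "dirichlet_solution a b f a = 0" "dirichlet_solution a b f b = 0"
proof -
  show "dirichlet_solution a b f a = 0" by (simp add: dirichlet_solution_def)
  have "integral {a..b} (\<lambda>x. c - integral {a..x} f) = c * (b - a) - integral {a..b} (\<lambda>x. integral {a..x} f)" for c
    using assms integrable_continuous_real[OF continuous_on_primitive[OF L2_D(3)[OF assms(2)]]]
    by (subst Henstock_Kurzweil_Integration.integral_diff) (auto intro: integrable_continuous_real)
  then show "dirichlet_solution a b f b = 0"
    using assms(1) by (simp add: dirichlet_solution_def dirichlet_slope_def[abs_def])
qed

lemma has_weak_deriv_dirichlet_solution:
  assumes "a \<le> b" "f \<in> L2 a b"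
  shows "has_weak_deriv a b 1 (dirichlet_solution a b f) (dirichlet_slope a b f)"
  using has_weak_deriv_primitive[OF dirichlet_slope_L2[OF assms(2)] assms(1), of 0]
  by (simp add: dirichlet_solution_def[abs_def])

lemma has_weak_deriv_dirichlet_slope:
  assumes "a \<le> b" "f \<in> L2 a b"
  shows "has_weak_deriv a b 1 (dirichlet_slope a b f) (\<lambda>x. - f x)"
  using has_weak_deriv_primitive[OF L2_uminus[OF assms(2)] assms(1)]
  by (simp add: dirichlet_slope_def[abs_def])

lemma has_weak_deriv_2_dirichlet_solution:
  assumes "a \<le> b" "f \<in> L2 a b"
  shows "has_weak_deriv a b 2 (dirichlet_solution a b f) (\<lambda>x. - f x)"
  using has_weak_deriv_dirichlet_solution[OF assms] has_weak_deriv_dirichlet_slope[OF assms]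
    test_function_deriv[of _ a b]
  by (auto simp: has_weak_deriv_def numeral_2_eq_2)

lemma dirichlet_solution_H2_0:
  assumes "a < b" "f \<in> L2 a b"
  shows "dirichlet_solution a b f \<in> H2_0 a b"
    "L2_eq a b (\<lambda>x. - weak_deriv a b 2 (dirichlet_solution a b f) x) f"
proof -
  have ab: "a \<le> b" using assms(1) by simp
  note w = has_weak_deriv_dirichlet_solution[OF ab assms(2)] has_weak_deriv_2_dirichlet_solution[OF ab assms(2)]
  have "has_weak_deriv a b 0 (dirichlet_solution a b f) (dirichlet_solution a b f)"
    using dirichlet_solution_L2[OF assms(2)] by (simp add: has_weak_deriv_def)
  moreover have "n = 0 \<or> n = 1 \<or> n = 2" if "n \<le> 2" for n :: nat using that by auto
  ultimately have "\<exists>v. has_weak_deriv a b n (dirichlet_solution a b f) v" if "n \<le> 2" for n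
    using w that by metis
  then show "dirichlet_solution a b f \<in> H2_0 a b"
    using dirichlet_solution_L2 dirichlet_solution_boundary dirichlet_solution_continuous assms
    by (auto simp: H2_0_def sobolev_H_def)
  have "L2_eq a b (weak_deriv a b 2 (dirichlet_solution a b f)) (\<lambda>x. - f x)"
    by (rule weak_deriv_L2_eq[OF w(2)])
  then show "L2_eq a b (\<lambda>x. - weak_deriv a b 2 (dirichlet_solution a b f) x) f"
    unfolding L2_eq_def by eventually_elim simp
qed

text \<open>
  Apply du Bois-Reymond twice to the difference from the explicit solution: its weak
  slope is constant because the second weak derivatives agree, and subtracting the corresponding
  linear function leaves a function with weak derivative 0. The difference is therefore affine,
  and the two boundary values annihilate it.
\<close>

lemma dirichlet_solution_unique:
  assumes ab: "a < b" and f: "f \<in> L2 a b" and y: "y \<in> H2_0 a b"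
    and eq: "L2_eq a b (\<lambda>x. - weak_deriv a b 2 y x) f" and x: "x \<in> {a..b}"
  shows "y x = dirichlet_solution a b f x"
proof -
  let ?s = "dirichlet_solution a b f" and ?s' = "dirichlet_slope a b f"
  define v where "v = weak_deriv a b 1 y"
  define w where "w = weak_deriv a b 2 y"
  have ab': "a \<le> b" using ab by simp
  have yL2: "y \<in> L2 a b" and yc: "continuous_on {a..b} y" and y0: "y a = 0" "y b = 0"
    and ex: "\<And>n. n \<le> 2 \<Longrightarrow> \<exists>v. has_weak_deriv a b n y v"
    using y by (auto simp: H2_0_def sobolev_H_def)
  from ex[of 1] ex[of 2] have yv: "has_weak_deriv a b 1 y v" and yw: "has_weak_deriv a b 2 y w"
    unfolding v_def w_def by (auto intro: has_weak_deriv_weak_deriv simp del: One_nat_def)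
  have vL2: "v \<in> L2 a b" and wL2: "w \<in> L2 a b" using yv yw by (auto simp: has_weak_deriv_def)
  have "L2_eq a b (\<lambda>x. w x - - f x) (\<lambda>x. 0)"
    using eq unfolding L2_eq_def w_def by eventually_elim simp
  moreover have "has_weak_deriv a b 1 (\<lambda>x. v x - ?s' x) (\<lambda>x. w x - - f x)"
    using has_weak_deriv_diff[OF vL2 has_weak_deriv_second_imp_first[OF yv yw]
        dirichlet_slope_L2[OF f] has_weak_deriv_dirichlet_slope[OF ab' f]] .
  ultimately have "has_weak_deriv a b 1 (\<lambda>x. v x - ?s' x) (\<lambda>x. 0)"
    using has_weak_deriv_cong L2_continuous[OF continuous_on_const] by blast
  then obtain C where C: "AE x in lebesgue_on {a..b}. v x - ?s' x = C"
    using has_weak_deriv_zero_imp_const[OF ab L2_diff[OF vL2 dirichlet_slope_L2[OF f]]] by blast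
  \<comment> \<open>The linear function \<open>C * x\<close> is written as a primitive, to have its weak derivative at hand.\<close>
  define z where "z x = (y x - ?s x) - (C * a + integral {a..x} (\<lambda>_. C))" for x
  have lin: "continuous_on {a..b} (\<lambda>x. C * a + integral {a..x} (\<lambda>_. C))"
    by (intro continuous_intros continuous_on_primitive) auto
  have zc: "continuous_on {a..b} z"
    unfolding z_def by (intro continuous_intros lin yc dirichlet_solution_continuous f)
  have "L2_eq a b (\<lambda>x. (v x - ?s' x) - C) (\<lambda>x. 0)"
    using C unfolding L2_eq_def by eventually_elim simp
  moreover have "has_weak_deriv a b 1 z (\<lambda>x. (v x - ?s' x) - C)"
    unfolding z_def
    by (rule has_weak_deriv_diff
        [OF L2_diff[OF yL2 dirichlet_solution_L2[OF f]]
            has_weak_deriv_diff[OF yL2 yv dirichlet_solution_L2[OF f] has_weak_deriv_dirichlet_solution[OF ab' f]]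
            L2_continuous[OF lin]
            has_weak_deriv_primitive[OF L2_continuous[OF continuous_on_const] ab']])
  ultimately have "has_weak_deriv a b 1 z (\<lambda>x. 0)"
    using has_weak_deriv_cong L2_continuous[OF continuous_on_const] by blast
  then obtain K where "AE x in lebesgue_on {a..b}. z x = K"
    using has_weak_deriv_zero_imp_const[OF ab L2_continuous[OF zc]] by blast
  then have K: "z x = K" if "x \<in> {a..b}" for x
    using continuous_AE_const_imp_const[OF zc ab _ that] by blast
  have z: "z x = y x - ?s x - C * x" if "x \<in> {a..b}" for x
    using that by (simp add: z_def algebra_simps)
  have "- (C * a) = K" "- (C * b) = K"
    using K[of a] K[of b] z[of a] z[of b] y0 dirichlet_solution_boundary[OF ab f] ab by auto
  then have "C * (b - a) = 0" unfolding right_diff_distrib by linarith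
  then have "C = 0" "K = 0" using ab \<open>- (C * a) = K\<close> by auto
  then show ?thesis using K[OF x] z[OF x] by simp
qed

lemma neg_inv_laplacian_spec:
  assumes "a < b" "f \<in> L2 a b"
  shows "neg_inv_laplacian a b f \<in> H2_0 a b"
    "L2_eq a b (\<lambda>x. - weak_deriv a b 2 (neg_inv_laplacian a b f) x) f"
  using someI[of "\<lambda>y. y \<in> H2_0 a b \<and> L2_eq a b (\<lambda>x. - weak_deriv a b 2 y x) f",
      OF conjI[OF dirichlet_solution_H2_0[OF assms]]]
  by (auto simp: neg_inv_laplacian_def)

lemma neg_inv_laplacian_eq:
  assumes "a < b" "f \<in> L2 a b" "x \<in> {a..b}"
  shows "neg_inv_laplacian a b f x = dirichlet_solution a b f x"
  using dirichlet_solution_unique neg_inv_laplacian_spec assms by blast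

lemma neg_inv_laplacian_L2:
  assumes "a < b" "f \<in> L2 a b"
  shows "neg_inv_laplacian a b f \<in> L2 a b"
  using neg_inv_laplacian_spec(1)[OF assms] by (auto simp: H2_0_def sobolev_H_def)

text \<open>
  The chosen solution agrees with the explicit one on \<open>{a..b}\<close>, hence has the same weak derivatives.
  The chosen weak derivative is then pinned down almost everywhere.
\<close>

lemma weak_deriv_neg_inv_laplacian:
  assumes ab: "a < b" and f: "f \<in> L2 a b"
  shows "weak_deriv a b 1 (neg_inv_laplacian a b f) \<in> L2 a b"
    "L2_eq a b (weak_deriv a b 1 (neg_inv_laplacian a b f)) (dirichlet_slope a b f)"
proof -
  have "(LINT x|lebesgue_on {a..b}. neg_inv_laplacian a b f x * (deriv ^^ 1) \<eta> x)
      = (LINT x|lebesgue_on {a..b}. dirichlet_solution a b f x * (deriv ^^ 1) \<eta> x)" for \<eta>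
    by (intro Bochner_Integration.integral_cong) (auto simp: neg_inv_laplacian_eq[OF ab f])
  then have *: "has_weak_deriv a b 1 (neg_inv_laplacian a b f) (dirichlet_slope a b f)"
    using has_weak_deriv_dirichlet_solution[OF less_imp_le[OF ab] f] by (simp add: has_weak_deriv_def)
  from weak_deriv_L2_eq[OF this]
  show "L2_eq a b (weak_deriv a b 1 (neg_inv_laplacian a b f)) (dirichlet_slope a b f)" .
  from has_weak_deriv_weak_deriv[OF *]
  show "weak_deriv a b 1 (neg_inv_laplacian a b f) \<in> L2 a b" by (simp add: has_weak_deriv_def)
qed

lemma primitive_cong_L2_eq:
  assumes f: "f \<in> L2 a b" and g: "g \<in> L2 a b" and eq: "L2_eq a b f g" and x: "x \<in> {a..b}"
  shows "integral {a..x} f = integral {a..x} g"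
proof -
  have "(LINT t|lebesgue_on {a..b}. indicator {..x} t * f t) = (LINT t|lebesgue_on {a..b}. indicator {..x} t * g t)"
  proof (rule integral_cong_AE)
    show "AE t in lebesgue_on {a..b}. indicator {..x} t * f t = indicator {..x} t * g t"
      using eq unfolding L2_eq_def by eventually_elim simp
  qed (use integrable_Icc_indicator[OF L2_D(3)[OF f], of "{..x}"]
         integrable_Icc_indicator[OF L2_D(3)[OF g], of "{..x}"] in auto)
  moreover have "{..x} \<inter> {a..b} = {a..x}" using x by auto
  ultimately show ?thesis
    using integral_indicator_Icc[OF L2_D(3)[OF f], of "{..x}"] integral_indicator_Icc[OF L2_D(3)[OF g], of "{..x}"]
    by simp
qed

lemma dirichlet_slope_cong_L2_eq:
  assumes "f \<in> L2 a b" "g \<in> L2 a b" "L2_eq a b f g" "x \<in> {a..b}"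
  shows "dirichlet_slope a b f x = dirichlet_slope a b g x"
proof -
  have "integral {a..b} (\<lambda>s. integral {a..s} f) = integral {a..b} (\<lambda>s. integral {a..s} g)"
    using primitive_cong_L2_eq[OF assms(1-3)] by (rule Henstock_Kurzweil_Integration.integral_cong)
  then show ?thesis using primitive_cong_L2_eq[OF assms] by (simp add: dirichlet_slope_def)
qed

lemma dirichlet_slope_lincomb:
  assumes f: "f \<in> L2 a b" and g: "g \<in> L2 a b" and x: "x \<in> {a..b}"
  shows "dirichlet_slope a b (\<lambda>t. p * f t + q * g t) x
       = p * dirichlet_slope a b f x + q * dirichlet_slope a b g x"
proof -
  have F: "integral {a..s} (\<lambda>t. p * f t + q * g t) = p * integral {a..s} f + q * integral {a..s} g"
    if "s \<in> {a..b}" for s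
  proof -
    have "f integrable_on {a..s}" "g integrable_on {a..s}"
      using that integrable_Icc_HK[OF L2_D(3)[OF f]] integrable_Icc_HK[OF L2_D(3)[OF g]]
      by (auto intro: integrable_subinterval_real)
    then show ?thesis by (intro integral_unique has_integral_add has_integral_mult_right integrable_integral)
  qed
  have "integral {a..b} (\<lambda>s. integral {a..s} (\<lambda>t. p * f t + q * g t))
      = integral {a..b} (\<lambda>s. p * integral {a..s} f + q * integral {a..s} g)"
    using F by (intro Henstock_Kurzweil_Integration.integral_cong) auto
  also have "\<dots> = p * integral {a..b} (\<lambda>s. integral {a..s} f) + q * integral {a..b} (\<lambda>s. integral {a..s} g)"
  proof -
    have "(\<lambda>s. integral {a..s} f) integrable_on {a..b}" "(\<lambda>s. integral {a..s} g) integrable_on {a..b}"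
      using f g by (auto intro!: integrable_continuous_real continuous_on_primitive L2_D(3))
    then show ?thesis by (intro integral_unique has_integral_add has_integral_mult_right integrable_integral)
  qed
  finally show ?thesis
    by (simp add: dirichlet_slope_def F[OF x] add_divide_distrib algebra_simps)
qed

text \<open>
  Integration by parts: \<open>- f\<close> is the derivative of the slope of \<open>f\<close>, and the solution for \<open>g\<close>
  vanishes at both ends.
\<close>

lemma dirichlet_green:
  assumes ab: "a < b" and f: "f \<in> L2 a b" and g: "g \<in> L2 a b"
  shows "(LINT x|lebesgue_on {a..b}. dirichlet_slope a b f x * dirichlet_slope a b g x)
       = (LINT x|lebesgue_on {a..b}. f x * dirichlet_solution a b g x)"
proof -
  let ?M = "lebesgue_on {a..b}"
  let ?g' = "dirichlet_slope a b g"
  define c where "c = integral {a..b} (\<lambda>s. integral {a..s} f) / (b - a)"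
  have g': "integrable ?M ?g'" using g by (intro L2_D(3) dirichlet_slope_L2)
  have F: "continuous_on {a..b} (\<lambda>x. integral {a..x} f)" using f by (intro continuous_on_primitive L2_D(3))
  have parts: "(LINT x|?M. integral {a..x} f * ?g' x) + (LINT x|?M. f x * dirichlet_solution a b g x) = 0"
    using integral_by_parts_primitives[OF L2_D(3)[OF f] g'] dirichlet_solution_boundary(2)[OF ab g]
    by (simp add: dirichlet_solution_def[abs_def])
  have "(LINT x|?M. ?g' x) = 0"
    using dirichlet_solution_boundary(2)[OF ab g] by (simp add: dirichlet_solution_def integral_Icc_HK[OF g'])
  moreover have "(LINT x|?M. dirichlet_slope a b f x * ?g' x)
      = c * (LINT x|?M. ?g' x) - (LINT x|?M. integral {a..x} f * ?g' x)"
    using g' integrable_Icc_continuous_mult[OF g' F]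
    by (simp add: dirichlet_slope_def[of a b f] left_diff_distrib flip: c_def)
  ultimately show ?thesis using parts by simp
qed

text \<open>
  A continuous slope of zero energy vanishes identically; since the slope is a constant minus the
  primitive of \<open>f\<close>, that primitive vanishes as well, and so does \<open>f\<close> almost everywhere.
\<close>

lemma dirichlet_slope_energy_zero:
  assumes ab: "a < b" and f: "f \<in> L2 a b"
    and 0: "(LINT x|lebesgue_on {a..b}. dirichlet_slope a b f x * dirichlet_slope a b f x) = 0"
  shows "L2_eq a b f (\<lambda>x. 0)"
proof -
  let ?s = "dirichlet_slope a b f"
  have c: "continuous_on {a..b} (\<lambda>x. ?s x * ?s x)"
    using f by (intro continuous_intros dirichlet_slope_continuous)
  then have "integral {a..b} (\<lambda>x. ?s x * ?s x) = 0"
    using 0 by (simp add: integral_Icc_HK continuous_on_integrable_Icc)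
  then have s: "?s x = 0" if "x \<in> {a..b}" for x
    using integral_eq_0_iff[OF c ab] that by auto
  have F: "integral {a..x} f = 0" if "x \<in> {a..b}" for x
    using s[OF that] s[of a] ab by (simp add: dirichlet_slope_def)
  have "AE x in lebesgue_on {a..b}. f x = 0"
  proof (rule AE_zero_if_subinterval_integrals_zero[OF L2_D(3)[OF f]])
    fix c d assume cd: "a < c" "c < d" "d < b"
    have "f integrable_on {a..d}"
      using cd integrable_Icc_HK[OF L2_D(3)[OF f]] by (auto intro: integrable_subinterval_real)
    then have "integral {a..c} f + integral {c..d} f = integral {a..d} f"
      using cd by (intro Henstock_Kurzweil_Integration.integral_combine) auto
    then show "integral {c..d} f = 0" using F[of c] F[of d] cd by simp
  qed
  then show ?thesis by (simp add: L2_eq_def)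
qed

section \<open>The Dirichlet form pulled back along a bounded operator\<close>

lemma L2_bounded_linear_maps_L2: "L2_bounded_linear a b T \<Longrightarrow> f \<in> L2 a b \<Longrightarrow> T f \<in> L2 a b"
  by (simp add: L2_bounded_linear_def)

lemma L2_lincomb: "f \<in> L2 a b \<Longrightarrow> g \<in> L2 a b \<Longrightarrow> (\<lambda>x. p * f x + q * g x) \<in> L2 a b"
  by (intro L2_add L2_cmult)

lemma L2_bounded_linear_lincomb:
  assumes T: "L2_bounded_linear a b T" and f: "f \<in> L2 a b" and g: "g \<in> L2 a b"
  shows "L2_eq a b (T (\<lambda>x. p * f x + q * g x)) (\<lambda>x. p * T f x + q * T g x)"
proof -
  have "L2_eq a b (T (\<lambda>x. p * f x + q * g x)) (\<lambda>x. T (\<lambda>x. p * f x) x + T (\<lambda>x. q * g x) x)"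
    using T L2_cmult[OF f] L2_cmult[OF g] by (simp add: L2_bounded_linear_def)
  moreover have "L2_eq a b (T (\<lambda>x. p * f x)) (\<lambda>x. p * T f x)" "L2_eq a b (T (\<lambda>x. q * g x)) (\<lambda>x. q * T g x)"
    using T f g by (auto simp: L2_bounded_linear_def)
  ultimately show ?thesis unfolding L2_eq_def by eventually_elim simp
qed

text \<open>
  The bilinear form \<open>(h, k) \<mapsto> \<integral> u\<^sub>h' u\<^sub>k'\<close>, where \<open>u\<^sub>h\<close> solves the Dirichlet problem with right-hand
  side \<open>T h\<close>. It is formed with the explicit continuous slopes, so that its algebra is not
  disturbed by the choice of representatives.
\<close>

definition dirichlet_energy ::
  "real \<Rightarrow> real \<Rightarrow> ((real \<Rightarrow> real) \<Rightarrow> real \<Rightarrow> real) \<Rightarrow> (real \<Rightarrow> real) \<Rightarrow> (real \<Rightarrow> real) \<Rightarrow> real" where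
  "dirichlet_energy a b T h k =
     (LINT x|lebesgue_on {a..b}. dirichlet_slope a b (T h) x * dirichlet_slope a b (T k) x)"

lemma dirichlet_energy_commute: "dirichlet_energy a b T h k = dirichlet_energy a b T k h"
  by (simp add: dirichlet_energy_def mult.commute)

text \<open>
  \<open>T\<close> is linear only up to null sets, but passing to the slope integrates, so linearity holds at
  every point.
\<close>

lemma dirichlet_slope_bounded_linear_lincomb:
  assumes T: "L2_bounded_linear a b T" and h: "h \<in> L2 a b" "k \<in> L2 a b" and x: "x \<in> {a..b}"
  shows "dirichlet_slope a b (T (\<lambda>x. p * h x + q * k x)) x
       = p * dirichlet_slope a b (T h) x + q * dirichlet_slope a b (T k) x"
proof -
  note TL2 = L2_bounded_linear_maps_L2[OF T]
  have "dirichlet_slope a b (T (\<lambda>x. p * h x + q * k x)) x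
      = dirichlet_slope a b (\<lambda>x. p * T h x + q * T k x) x"
    using h x by (intro dirichlet_slope_cong_L2_eq L2_bounded_linear_lincomb[OF T] L2_lincomb TL2)
  also have "\<dots> = p * dirichlet_slope a b (T h) x + q * dirichlet_slope a b (T k) x"
    using h x by (intro dirichlet_slope_lincomb TL2)
  finally show ?thesis .
qed

lemma dirichlet_energy_lincomb:
  assumes T: "L2_bounded_linear a b T" and "h \<in> L2 a b" "k \<in> L2 a b" "l \<in> L2 a b"
  shows "dirichlet_energy a b T (\<lambda>x. p * h x + q * k x) l
       = p * dirichlet_energy a b T h l + q * dirichlet_energy a b T k l"
proof -
  note TL2 = L2_bounded_linear_maps_L2[OF T]
  have "dirichlet_energy a b T (\<lambda>x. p * h x + q * k x) l
      = (LINT x|lebesgue_on {a..b}.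
           p * (dirichlet_slope a b (T h) x * dirichlet_slope a b (T l) x)
         + q * (dirichlet_slope a b (T k) x * dirichlet_slope a b (T l) x))"
    unfolding dirichlet_energy_def
    by (intro Bochner_Integration.integral_cong)
       (auto simp: dirichlet_slope_bounded_linear_lincomb[OF T assms(2,3)] algebra_simps)
  also have "\<dots> = p * dirichlet_energy a b T h l + q * dirichlet_energy a b T k l"
    using assms TL2 by (simp add: dirichlet_energy_def L2_mult_integrable dirichlet_slope_L2)
  finally show ?thesis .
qed

lemma dirichlet_energy_nonneg: "0 \<le> dirichlet_energy a b T h h"
  by (simp add: dirichlet_energy_def)

text \<open>
  Zero energy forces \<open>T h = 0\<close> almost everywhere, and injectivity removes \<open>T\<close>. Conversely,
  it is the boundedness of \<open>T\<close> that makes it send null functions to null functions.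
\<close>

lemma dirichlet_energy_eq_0_iff:
  assumes ab: "a < b" and T: "L2_bounded_linear a b T" and inj: "L2_injective a b T" and h: "h \<in> L2 a b"
  shows "dirichlet_energy a b T h h = 0 \<longleftrightarrow> L2_eq a b h (\<lambda>x. 0)"
proof
  note TL2 = L2_bounded_linear_maps_L2[OF T]
  have T0: "L2_eq a b (T (\<lambda>x. 0)) (\<lambda>x. 0)"
    using L2_bounded_linear_lincomb[OF T h h, of 0 0] by simp
  have z: "(\<lambda>x. 0) \<in> L2 a b" by (rule L2_continuous[OF continuous_on_const])
  {
    assume "dirichlet_energy a b T h h = 0"
    then have "L2_eq a b (T h) (\<lambda>x. 0)"
      using dirichlet_slope_energy_zero[OF ab TL2[OF h]] by (simp add: dirichlet_energy_def)
    with T0 have "L2_eq a b (T h) (T (\<lambda>x. 0))"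
      unfolding L2_eq_def by eventually_elim simp
    then show "L2_eq a b h (\<lambda>x. 0)" using inj h z by (simp add: L2_injective_def)
  next
    assume h0: "L2_eq a b h (\<lambda>x. 0)"
    obtain C where C: "\<forall>f\<in>L2 a b. L2_norm a b (T f) \<le> C * L2_norm a b f"
      using T unfolding L2_bounded_linear_def by blast
    have "L2_inner a b h h = 0"
      unfolding L2_inner_def
      by (rule integral_eq_zero_AE) (use h0 in \<open>simp add: L2_eq_def\<close>)
    then have "L2_norm a b (T h) \<le> 0" using bspec[OF C h] by (simp add: L2_norm_def)
    then have "(LINT x|lebesgue_on {a..b}. (T h x)\<^sup>2) = 0"
      by (simp add: L2_norm_def L2_inner_def power2_eq_square antisym)
    then have "L2_eq a b (T h) (\<lambda>x. 0)"
      using integral_nonneg_eq_0_iff_AE[OF L2_D(2)[OF TL2[OF h]]] by (simp add: L2_eq_def)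
    then have "dirichlet_slope a b (T h) x = 0" if "x \<in> {a..b}" for x
      using dirichlet_slope_cong_L2_eq[OF TL2[OF h] z _ that] by (simp add: dirichlet_slope_def)
    then have "dirichlet_energy a b T h h = (LINT x|lebesgue_on {a..b}. 0)"
      unfolding dirichlet_energy_def by (intro Bochner_Integration.integral_cong) auto
    then show "dirichlet_energy a b T h h = 0" by simp
  }
qed

lemma integral_mult_neg_inv_laplacian:
  assumes ab: "a < b" and T: "L2_bounded_linear a b T" and h: "h \<in> L2 a b" "k \<in> L2 a b"
  shows "(LINT x|lebesgue_on {a..b}. T h x * neg_inv_laplacian a b (T k) x) = dirichlet_energy a b T h k"
proof -
  note TL2 = L2_bounded_linear_maps_L2[OF T]
  have "(LINT x|lebesgue_on {a..b}. T h x * neg_inv_laplacian a b (T k) x)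
      = (LINT x|lebesgue_on {a..b}. T h x * dirichlet_solution a b (T k) x)"
    by (intro Bochner_Integration.integral_cong) (auto simp: neg_inv_laplacian_eq[OF ab TL2[OF h(2)]])
  then show ?thesis using dirichlet_green[OF ab TL2 TL2] h by (simp add: dirichlet_energy_def)
qed

lemma integral_weak_derivs_neg_inv_laplacian:
  assumes ab: "a < b" and T: "L2_bounded_linear a b T" and h: "h \<in> L2 a b" "k \<in> L2 a b"
  shows "(LINT x|lebesgue_on {a..b}. weak_deriv a b 1 (neg_inv_laplacian a b (T h)) x
                                    * weak_deriv a b 1 (neg_inv_laplacian a b (T k)) x)
       = dirichlet_energy a b T h k"
  unfolding dirichlet_energy_def
proof (rule integral_cong_AE)
  note TL2 = L2_bounded_linear_maps_L2[OF T]
  note wh = weak_deriv_neg_inv_laplacian[OF ab TL2[OF h(1)]]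
  note wk = weak_deriv_neg_inv_laplacian[OF ab TL2[OF h(2)]]
  show "AE x in lebesgue_on {a..b}. weak_deriv a b 1 (neg_inv_laplacian a b (T h)) x
                                    * weak_deriv a b 1 (neg_inv_laplacian a b (T k)) x
      = dirichlet_slope a b (T h) x * dirichlet_slope a b (T k) x"
    using wh(2) wk(2) unfolding L2_eq_def by eventually_elim simp
qed (use h weak_deriv_neg_inv_laplacian[OF ab L2_bounded_linear_maps_L2[OF T]] 
      dirichlet_slope_L2[OF L2_bounded_linear_maps_L2[OF T]] L2_mult_integrable in
     \<open>auto intro!: borel_measurable_integrable\<close>)

section \<open>Quadratic misfit functionals\<close>

text \<open>
  Along a line a quadratic functional is a polynomial of degree 2 in the parameter, so its Gateaux
  differential is the linear coefficient.
\<close>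

lemma quadratic_tendsto_linear_coefficient:
  "((\<lambda>\<epsilon>::real. (p * \<epsilon> + q * \<epsilon>\<^sup>2) / \<epsilon>) \<longlongrightarrow> p) (at 0)"
proof (rule Lim_transform_eventually)
  show "((\<lambda>\<epsilon>. p + q * \<epsilon>) \<longlongrightarrow> p) (at 0)" by (auto intro!: tendsto_eq_intros)
  show "\<forall>\<^sub>F \<epsilon> in at 0. p + q * \<epsilon> = (p * \<epsilon> + q * \<epsilon>\<^sup>2) / \<epsilon>"
    by (auto simp: eventually_at_filter power2_eq_square field_simps)
qed

lemma gateaux_diff_eqI: "has_gateaux_diff F \<psi> h D \<Longrightarrow> gateaux_diff F \<psi> h = D"
  unfolding gateaux_diff_def has_gateaux_diff_def
  by (rule the_equality) (auto intro: tendsto_unique[OF at_neq_bot])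

lemma gateaux_diff2_eqI: "has_gateaux_diff2 F \<psi> h k D \<Longrightarrow> gateaux_diff2 F \<psi> h k = D"
  unfolding gateaux_diff2_def has_gateaux_diff2_def has_gateaux_diff_def
  by (rule the_equality) (auto intro: tendsto_unique[OF at_neq_bot])

text \<open>
  Calculus and convexity for \<open>F \<psi> = B (\<phi> - \<psi>) (\<phi> - \<psi>)\<close> with a positive semidefinite form \<open>B\<close>.
  The expanded expression is assumed because it avoids differences inside \<open>B\<close> and
  makes every identity below a polynomial one in values of \<open>B\<close>.
\<close>

locale L2_quadratic_misfit =
  fixes a b :: real and B :: "(real \<Rightarrow> real) \<Rightarrow> (real \<Rightarrow> real) \<Rightarrow> real"
    and \<phi> :: "real \<Rightarrow> real" and F :: "(real \<Rightarrow> real) \<Rightarrow> real"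
  assumes phi: "\<phi> \<in> L2 a b"
    and B_commute: "B h k = B k h"
    and B_lincomb: "h \<in> L2 a b \<Longrightarrow> k \<in> L2 a b \<Longrightarrow> l \<in> L2 a b \<Longrightarrow>
      B (\<lambda>x. p * h x + q * k x) l = p * B h l + q * B k l"
    and B_nonneg: "h \<in> L2 a b \<Longrightarrow> 0 \<le> B h h"
    and F_eq: "\<psi> \<in> L2 a b \<Longrightarrow> F \<psi> = B \<phi> \<phi> - 2 * B \<phi> \<psi> + B \<psi> \<psi>"
begin

lemma B_lincomb_right:
  assumes "h \<in> L2 a b" "k \<in> L2 a b" "l \<in> L2 a b"
  shows "B l (\<lambda>x. p * h x + q * k x) = p * B l h + q * B l k"
  using B_lincomb[OF assms] B_commute by metis

lemma B_lincomb_self: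
  assumes "h \<in> L2 a b" "k \<in> L2 a b"
  shows "B (\<lambda>x. p * h x + q * k x) (\<lambda>x. p * h x + q * k x)
       = p\<^sup>2 * B h h + 2 * p * q * B h k + q\<^sup>2 * B k k"
  using assms B_commute[of k h]
  by (simp add: B_lincomb B_lincomb_right L2_lincomb power2_eq_square algebra_simps)

lemma F_eq_diff:
  assumes "\<psi> \<in> L2 a b"
  shows "F \<psi> = B (\<lambda>x. \<phi> x - \<psi> x) (\<lambda>x. \<phi> x - \<psi> x)"
  using B_lincomb_self[OF phi assms, of 1 "-1"] by (simp add: F_eq[OF assms])

lemma has_gateaux_diff_F:
  assumes \<psi>: "\<psi> \<in> L2 a b" and h: "h \<in> L2 a b"
  shows "has_gateaux_diff F \<psi> h (- 2 * (B h \<phi> - B h \<psi>))"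
proof -
  have "F (\<lambda>x. \<psi> x + \<epsilon> * h x) - F \<psi> = (- 2 * (B h \<phi> - B h \<psi>)) * \<epsilon> + B h h * \<epsilon>\<^sup>2" for \<epsilon>
    using F_eq[OF L2_lincomb[OF \<psi> h, of 1 \<epsilon>]] F_eq[OF \<psi>] B_lincomb_self[OF \<psi> h, of 1 \<epsilon>]
      B_lincomb_right[OF \<psi> h phi, of 1 \<epsilon>] B_commute[of h \<phi>] B_commute[of h \<psi>]
    by (simp add: algebra_simps)
  then show ?thesis
    unfolding has_gateaux_diff_def using quadratic_tendsto_linear_coefficient by presburger
qed

lemma has_gateaux_diff2_F:
  assumes \<psi>: "\<psi> \<in> L2 a b" and h: "h \<in> L2 a b" and k: "k \<in> L2 a b"
  shows "has_gateaux_diff2 F \<psi> h k (2 * B h k)"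
proof -
  have D: "gateaux_diff F \<theta> k = - 2 * (B k \<phi> - B k \<theta>)" if "\<theta> \<in> L2 a b" for \<theta>
    using that k by (intro gateaux_diff_eqI has_gateaux_diff_F)
  have "gateaux_diff F (\<lambda>x. \<psi> x + \<epsilon> * h x) k - gateaux_diff F \<psi> k = (2 * B h k) * \<epsilon> + 0 * \<epsilon>\<^sup>2" for \<epsilon>
    using D[OF L2_lincomb[OF \<psi> h, of 1 \<epsilon>]] D[OF \<psi>] B_lincomb_right[OF \<psi> h k, of 1 \<epsilon>] B_commute[of h k]
    by (simp add: algebra_simps)
  then show ?thesis
    unfolding has_gateaux_diff2_def has_gateaux_diff_def
    using quadratic_tendsto_linear_coefficient by presburger
qed

text \<open>
  The defect in the convexity inequality of a quadratic functional depends only on \<open>\<psi>1 - \<psi>2\<close>;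
  its sign gives convexity, and strict convexity when \<open>B\<close> is definite.
\<close>

lemma convexity_gap:
  assumes "\<psi>1 \<in> L2 a b" "\<psi>2 \<in> L2 a b"
  shows "(1 - t) * F \<psi>1 + t * F \<psi>2 - F (\<lambda>x. (1 - t) * \<psi>1 x + t * \<psi>2 x)
       = t * (1 - t) * B (\<lambda>x. \<psi>1 x - \<psi>2 x) (\<lambda>x. \<psi>1 x - \<psi>2 x)"
proof -
  have "B (\<lambda>x. \<psi>1 x - \<psi>2 x) (\<lambda>x. \<psi>1 x - \<psi>2 x) = B \<psi>1 \<psi>1 - 2 * B \<psi>1 \<psi>2 + B \<psi>2 \<psi>2"
    using B_lincomb_self[OF assms, of 1 "-1"] by simp
  then show ?thesis
    by (simp only: F_eq assms L2_lincomb B_lincomb_self B_lincomb_right phi)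
       (simp add: power2_eq_square algebra_simps)
qed

lemma convex_F: "L2_convex a b F"
  unfolding L2_convex_def
proof (intro ballI allI impI)
  fix \<psi>1 \<psi>2 t assume *: "\<psi>1 \<in> L2 a b" "\<psi>2 \<in> L2 a b" "0 \<le> t \<and> t \<le> (1::real)"
  then have "0 \<le> t * (1 - t) * B (\<lambda>x. \<psi>1 x - \<psi>2 x) (\<lambda>x. \<psi>1 x - \<psi>2 x)"
    by (intro mult_nonneg_nonneg B_nonneg L2_diff) auto
  then show "F (\<lambda>x. (1 - t) * \<psi>1 x + t * \<psi>2 x) \<le> (1 - t) * F \<psi>1 + t * F \<psi>2"
    using convexity_gap[OF *(1,2), of t] by linarith
qed

lemma global_min_F: "L2_global_min a b F \<phi>"
  using phi F_eq[OF phi] F_eq_diff B_nonneg L2_diff[OF phi] by (auto simp: L2_global_min_def)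

end

locale L2_definite_quadratic_misfit = L2_quadratic_misfit +
  assumes B_zero_iff: "h \<in> L2 a b \<Longrightarrow> B h h = 0 \<longleftrightarrow> L2_eq a b h (\<lambda>x. 0)"
begin

lemma strictly_convex_F: "L2_strictly_convex a b F"
  unfolding L2_strictly_convex_def
proof (intro ballI allI impI)
  fix \<psi>1 \<psi>2 t assume *: "\<psi>1 \<in> L2 a b" "\<psi>2 \<in> L2 a b" "\<not> L2_eq a b \<psi>1 \<psi>2 \<and> 0 < t \<and> t < (1::real)"
  let ?d = "\<lambda>x. \<psi>1 x - \<psi>2 x"
  have "?d \<in> L2 a b" using * by (intro L2_diff)
  moreover have "\<not> L2_eq a b ?d (\<lambda>x. 0)" using * by (simp add: L2_eq_def)
  ultimately have "0 < B ?d ?d" using B_nonneg B_zero_iff by (metis order_less_le)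
  then have "0 < t * (1 - t) * B ?d ?d" using * by simp
  then show "F (\<lambda>x. (1 - t) * \<psi>1 x + t * \<psi>2 x) < (1 - t) * F \<psi>1 + t * F \<psi>2"
    using convexity_gap[OF *(1,2), of t] by linarith
qed

lemma global_min_F_unique:
  assumes "L2_global_min a b F \<psi>"
  shows "L2_eq a b \<psi> \<phi>"
proof -
  have \<psi>: "\<psi> \<in> L2 a b" and "F \<psi> \<le> F \<phi>" using assms phi by (auto simp: L2_global_min_def)
  moreover have "F \<phi> = 0" using F_eq[OF phi] by simp
  ultimately have "B (\<lambda>x. \<phi> x - \<psi> x) (\<lambda>x. \<phi> x - \<psi> x) = 0"
    using F_eq_diff[OF \<psi>] B_nonneg[OF L2_diff[OF phi \<psi>]] by simp
  then have "L2_eq a b (\<lambda>x. \<phi> x - \<psi> x) (\<lambda>x. 0)" using B_zero_iff[OF L2_diff[OF phi \<psi>]] by simp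
  then show ?thesis unfolding L2_eq_def by eventually_elim simp
qed

lemma pos_def_gateaux_diff2_F:
  assumes "\<psi> \<in> L2 a b"
  shows "L2_pos_def_quadratic_form a b (gateaux_diff2 F \<psi>)"
proof -
  have D: "gateaux_diff2 F \<psi> h k = 2 * B h k" if "h \<in> L2 a b" "k \<in> L2 a b" for h k
    using that assms by (intro gateaux_diff2_eqI has_gateaux_diff2_F)
  show ?thesis
    unfolding L2_pos_def_quadratic_form_def
    using B_commute B_lincomb[of _ _ _ 1 1] B_lincomb[of _ _ _ _ 0] B_nonneg B_zero_iff
    by (auto simp: D L2_add L2_cmult)
qed

end

section \<open>The functional of the inverse problem\<close>

theorem theorem3p1:
  fixes a b :: real
    and T Ts :: "(real \<Rightarrow> real) \<Rightarrow> (real \<Rightarrow> real)"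
    and \<phi> g u :: "real \<Rightarrow> real"
    and U :: "(real \<Rightarrow> real) \<Rightarrow> (real \<Rightarrow> real)"
    and G2 :: "(real \<Rightarrow> real) \<Rightarrow> real"
  assumes ab: "a < b"
    and T: "L2_bounded_linear a b T"
    and Ts: "L2_is_adjoint a b T Ts"
    and phi: "\<phi> \<in> L2 a b"
    and g: "g = T \<phi>"
    and u: "u = neg_inv_laplacian a b g"
    and U: "\<And>\<psi>. U \<psi> = neg_inv_laplacian a b (T \<psi>)"
    and G2: "\<And>\<psi>. G2 \<psi> = (L2_norm a b (\<lambda>x. weak_deriv a b 1 u x - weak_deriv a b 1 (U \<psi>) x))\<^sup>2"
  shows "(L2_injective a b T \<longrightarrow>
      (\<forall>\<psi>\<in>L2 a b. G2 \<psi> =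
         (LINT x|lebesgue_on {a..b}.
            ((weak_deriv a b 1 u x)\<^sup>2 - (weak_deriv a b 1 (U \<psi>) x)\<^sup>2)
              - 2 * T \<psi> x * (u x - U \<psi> x))) \<and>
      (\<forall>\<psi>1\<in>L2 a b. \<forall>\<psi>2\<in>L2 a b. G2 \<psi>1 - G2 \<psi>2 =
         (LINT x|lebesgue_on {a..b}.
            -2 * T (\<lambda>y. \<psi>1 y - \<psi>2 y) x * (u x - (U \<psi>1 x + U \<psi>2 x) / 2))) \<and>
      (\<forall>\<psi>\<in>L2 a b. \<forall>h\<in>L2 a b. has_gateaux_diff G2 \<psi> h
         (LINT x|lebesgue_on {a..b}. T h x * (-2 * (u x - U \<psi> x)))) \<and>
      (\<forall>\<psi>\<in>L2 a b. is_L2_gradient a b G2 \<psi> (Ts (\<lambda>x. -2 * (u x - U \<psi> x)))) \<and>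
      (\<forall>\<psi>\<in>L2 a b. \<forall>h\<in>L2 a b. \<forall>k\<in>L2 a b.
         has_gateaux_diff2 G2 \<psi> h k (2 * L2_inner a b (neg_inv_laplacian a b (T h)) (T k))) \<and>
      (\<forall>\<psi>\<in>L2 a b. L2_pos_def_quadratic_form a b (gateaux_diff2 G2 \<psi>)) \<and>
      L2_strictly_convex a b G2 \<and>
      L2_global_min a b G2 \<phi> \<and>
      (\<forall>\<psi>. L2_global_min a b G2 \<psi> \<longrightarrow> L2_eq a b \<psi> \<phi>)) \<and>
    L2_convex a b G2"
proof -
  let ?M = "lebesgue_on {a..b}"
  let ?B = "dirichlet_energy a b T"
  let ?w = "\<lambda>\<psi>. weak_deriv a b 1 (U \<psi>)"
  have uU: "u = U \<phi>" by (simp add: u g U)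
  note TL2 = L2_bounded_linear_maps_L2[OF T]
  have UL2: "U \<psi> \<in> L2 a b" and wL2: "?w \<psi> \<in> L2 a b" if "\<psi> \<in> L2 a b" for \<psi>
    using neg_inv_laplacian_L2[OF ab TL2[OF that]] weak_deriv_neg_inv_laplacian(1)[OF ab TL2[OF that]]
    by (simp_all add: U)
  have TU: "(LINT x|?M. T h x * U k x) = ?B h k" and ww: "(LINT x|?M. ?w h x * ?w k x) = ?B h k"
    and ww_int: "integrable ?M (\<lambda>x. ?w h x * ?w k x)" and TU_int: "integrable ?M (\<lambda>x. T h x * U k x)"
    if "h \<in> L2 a b" "k \<in> L2 a b" for h k
    using integral_mult_neg_inv_laplacian[OF ab T that] integral_weak_derivs_neg_inv_laplacian[OF ab T that]
      L2_mult_integrable wL2 UL2 TL2 that by (simp_all add: U)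
  have G2_eq: "G2 \<psi> = ?B \<phi> \<phi> - 2 * ?B \<phi> \<psi> + ?B \<psi> \<psi>" if \<psi>: "\<psi> \<in> L2 a b" for \<psi>
  proof -
    have "G2 \<psi> = (LINT x|?M. (?w \<phi> x - ?w \<psi> x) * (?w \<phi> x - ?w \<psi> x))"
      by (simp add: G2 L2_norm_def L2_inner_def uU)
    also have "\<dots> = (LINT x|?M. ?w \<phi> x * ?w \<phi> x - 2 * (?w \<phi> x * ?w \<psi> x) + ?w \<psi> x * ?w \<psi> x)"
      by (simp add: algebra_simps)
    also have "\<dots> = ?B \<phi> \<phi> - 2 * ?B \<phi> \<psi> + ?B \<psi> \<psi>"
      using ww_int phi \<psi> by (simp add: ww del: One_nat_def)
    finally show ?thesis .
  qed
  interpret L2_quadratic_misfit a b ?B \<phi> G2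
    by unfold_locales (use phi G2_eq dirichlet_energy_lincomb[OF T] dirichlet_energy_nonneg
        in \<open>auto simp: dirichlet_energy_commute\<close>)
  have diff: "(LINT x|?M. T h x * (-2 * (u x - U \<psi> x))) = - 2 * (?B h \<phi> - ?B h \<psi>)"
    if "h \<in> L2 a b" "\<psi> \<in> L2 a b" for h \<psi>
  proof -
    have "(LINT x|?M. T h x * (-2 * (u x - U \<psi> x)))
        = (LINT x|?M. -2 * (T h x * U \<phi> x) + 2 * (T h x * U \<psi> x))"
      by (simp add: uU algebra_simps)
    then show ?thesis using TU_int TU phi that by simp
  qed
  have 1: "G2 \<psi> = (LINT x|?M. ((weak_deriv a b 1 u x)\<^sup>2 - (?w \<psi> x)\<^sup>2) - 2 * T \<psi> x * (u x - U \<psi> x))"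
    if \<psi>: "\<psi> \<in> L2 a b" for \<psi>
  proof -
    have "(LINT x|?M. ((weak_deriv a b 1 u x)\<^sup>2 - (?w \<psi> x)\<^sup>2) - 2 * T \<psi> x * (u x - U \<psi> x))
        = (LINT x|?M. ?w \<phi> x * ?w \<phi> x - ?w \<psi> x * ?w \<psi> x - 2 * (T \<psi> x * U \<phi> x) + 2 * (T \<psi> x * U \<psi> x))"
      by (simp add: uU power2_eq_square algebra_simps)
    also have "\<dots> = ?B \<phi> \<phi> - ?B \<psi> \<psi> - 2 * ?B \<psi> \<phi> + 2 * ?B \<psi> \<psi>"
      using ww_int TU_int phi \<psi> by (simp add: ww TU del: One_nat_def)
    finally show ?thesis using G2_eq[OF \<psi>] dirichlet_energy_commute[of a b T \<psi> \<phi>] by simp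
  qed
  have 2: "G2 \<psi>1 - G2 \<psi>2 = (LINT x|?M. -2 * T (\<lambda>y. \<psi>1 y - \<psi>2 y) x * (u x - (U \<psi>1 x + U \<psi>2 x) / 2))"
    if \<psi>: "\<psi>1 \<in> L2 a b" "\<psi>2 \<in> L2 a b" for \<psi>1 \<psi>2
  proof -
    let ?d = "\<lambda>y. \<psi>1 y - \<psi>2 y"
    have d: "?d \<in> L2 a b" by (intro L2_diff \<psi>)
    have lin: "?B ?d l = ?B \<psi>1 l - ?B \<psi>2 l" if "l \<in> L2 a b" for l
      using B_lincomb[OF \<psi> that, of 1 "-1"] by simp
    have "(LINT x|?M. -2 * T ?d x * (u x - (U \<psi>1 x + U \<psi>2 x) / 2))
        = (LINT x|?M. -2 * (T ?d x * U \<phi> x) + T ?d x * U \<psi>1 x + T ?d x * U \<psi>2 x)"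
      by (simp add: uU algebra_simps add_divide_distrib)
    also have "\<dots> = -2 * ?B ?d \<phi> + ?B ?d \<psi>1 + ?B ?d \<psi>2"
      using TU_int phi \<psi> d by (simp add: TU)
    finally show ?thesis
      using G2_eq[OF \<psi>(1)] G2_eq[OF \<psi>(2)] B_commute[of \<psi>2 \<psi>1] B_commute[of \<phi> \<psi>1] B_commute[of \<phi> \<psi>2]
      by (simp add: lin phi \<psi>)
  qed
  have 3: "has_gateaux_diff G2 \<psi> h (LINT x|?M. T h x * (-2 * (u x - U \<psi> x)))"
    if "\<psi> \<in> L2 a b" "h \<in> L2 a b" for \<psi> h
    unfolding diff[OF that(2,1)] by (rule has_gateaux_diff_F[OF that])
  have grad: "is_L2_gradient a b G2 \<psi> (Ts (\<lambda>x. -2 * (u x - U \<psi> x)))" if \<psi>: "\<psi> \<in> L2 a b" for \<psi>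
  proof -
    have r: "(\<lambda>x. -2 * (u x - U \<psi> x)) \<in> L2 a b"
      unfolding uU by (intro L2_cmult L2_diff UL2 phi \<psi>)
    then have "L2_inner a b h (Ts (\<lambda>x. -2 * (u x - U \<psi> x))) = (LINT x|?M. T h x * (-2 * (u x - U \<psi> x)))"
      if "h \<in> L2 a b" for h
      using Ts that by (simp add: L2_is_adjoint_def flip: L2_inner_def)
    then show ?thesis using 3[OF \<psi>] r Ts by (simp add: is_L2_gradient_def L2_is_adjoint_def)
  qed
  have 4: "has_gateaux_diff2 G2 \<psi> h k (2 * L2_inner a b (neg_inv_laplacian a b (T h)) (T k))"
    if "\<psi> \<in> L2 a b" "h \<in> L2 a b" "k \<in> L2 a b" for \<psi> h k
    using has_gateaux_diff2_F[OF that] TU[OF that(3,2)] B_commute[of h k]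
    by (simp add: L2_inner_def U mult.commute)
  show ?thesis
  proof (intro conjI impI)
    show "L2_convex a b G2" by (rule convex_F)
    show "L2_global_min a b G2 \<phi>" by (rule global_min_F)
    assume inj: "L2_injective a b T"
    interpret L2_definite_quadratic_misfit a b ?B \<phi> G2
      by unfold_locales (rule dirichlet_energy_eq_0_iff[OF ab T inj])
    show "L2_strictly_convex a b G2" by (rule strictly_convex_F)
    show "\<forall>\<psi>. L2_global_min a b G2 \<psi> \<longrightarrow> L2_eq a b \<psi> \<phi>" using global_min_F_unique by blast
    show "\<forall>\<psi>\<in>L2 a b. L2_pos_def_quadratic_form a b (gateaux_diff2 G2 \<psi>)"
      using pos_def_gateaux_diff2_F by blast
  qed (use 1 2 3 grad 4 in blast)+
qed

end
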